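(* Let $E$ be a finite or countable space equipped with the trivial distance $d(x,y)=\mathbf{1}_{x\neq y}$, let $N\geq1$, let $(P_{xy})_{x,y\in E}$ be a stochastic matrix and, for each $x\in E$, let $c_x:E^N\to\mathbb{R}_+$ be a non-negative function. Consider the (non-explosive) particle system on $E^N$ with infinitesimal generator $$\mathcal{L} f(\bar{x})=\sum_{i=1}^N c_{x_i}(\bar{x})\sum_{y\in E} P_{x_iy}\bigl(f(x_1,\ldots,x_{i-1},y,x_{i+1},\ldots,x_N)-f(\bar x)\bigr).$$ Then the coarse Ricci curvature $\sigma$ of this particle system satisfies $$\sigma\geq \inf_{\bar{x}\neq \bar{y}\in E^N,\ x\in\bar x,\,y\in\bar y} \theta_P(x,y)\, \bigl(c_x(\bar{x})\wedge c_y(\bar{y})\bigr)-\sup_{x\in E} (1-P_{xx})\|c_x\|_{Lip},$$ where $$\|c_x\|_{Lip}:=\sup_{\bar{x}\neq \bar{y}\in E^N\text{ s.t. }x\in \bar x\text{ and }x\in\bar y} \frac{|c_x(\bar{x})-c_x(\bar{y})|}{d(\bar{x},\bar{y})}.$$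
   Context: $E^N$ is endowed with $d(\bar x,\bar y)=\frac1N\sum_{i=1}^N d(x_i,y_i)$. The notation $x\in\bar x$ means that $x$ is one of the coordinates of $\bar x$. $a\wedge b=\min(a,b)$; the supremum of an empty set of non-negative numbers is $0$. $\theta_P(x,y)$ is the discrete-time coarse Ricci curvature of $P$ along $(x,y)$, $\theta_P(x,y)=1-\mathcal{W}_d(P_x,P_y)/d(x,y)$ where $P_x=(P_{xz})_{z\in E}$; since $d$ is the trivial distance it is given by $\theta_P(x,y)=1-\frac12\|P_x-P_y\|_{TV}$, with $\|P_x-P_y\|_{TV}=\sum_{z\in E}|P_{xz}-P_{yz}|$ (this formula is used for all $x,y$, so $\theta_P(x,x)=1$). The coarse Ricci curvature of a Markov process $\bar X$ on $E^N$ is the largest $\sigma\in[-\infty,+\infty]$ such that, for all $t\geq0$ and all $\bar x,\bar y\in E^N$, $\mathcal{W}_d\bigl(\mathbb{P}(\bar X_t\in\cdot\mid\bar X_0=\bar x),\mathbb{P}(\bar X_t\in\cdot\mid\bar X_0=\bar y)\bigr)\leq e^{-\sigma t}d(\bar x,\bar y)$, where $\mathcal{W}_d(\mu,\nu)=\inf_\pi\int d\,d\pi$ is the Wasserstein distance (infimum over couplings $\pi$ of $\mu$ and $\nu$). *)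

theory Defs
  imports "HOL-Probability.Probability"
begin

text \<open>
  A configuration in \<open>E\<^sup>N\<close> is a function \<open>'n \<Rightarrow> 'e\<close>, where \<open>'e\<close> is the countable space \<open>E\<close> and
  \<open>'n\<close> is a finite index type with \<open>CARD('n) = N\<close> elements; \<open>x \<in> range xs\<close> says that \<open>x\<close> is one of
  the coordinates of \<open>xs\<close>.
\<close>

section \<open>Distances, Wasserstein distance and coarse Ricci curvature\<close>

definition trivial_dist :: "'e \<Rightarrow> 'e \<Rightarrow> real" where
  "trivial_dist x y = (if x = y then 0 else 1)"

definition config_dist :: "('n::finite \<Rightarrow> 'e) \<Rightarrow> ('n \<Rightarrow> 'e) \<Rightarrow> real" where
  "config_dist xs ys = (\<Sum>i\<in>UNIV. trivial_dist (xs i) (ys i)) / real CARD('n)"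

definition couplings :: "'a measure \<Rightarrow> 'b measure \<Rightarrow> ('a \<times> 'b) measure set" where
  "couplings \<mu> \<nu> = {\<pi>. sets \<pi> = sets (\<mu> \<Otimes>\<^sub>M \<nu>) \<and> distr \<pi> \<mu> fst = \<mu> \<and> distr \<pi> \<nu> snd = \<nu>}"

definition wasserstein :: "('a \<Rightarrow> 'a \<Rightarrow> real) \<Rightarrow> 'a measure \<Rightarrow> 'a measure \<Rightarrow> ennreal" where
  "wasserstein d \<mu> \<nu> = (INF \<pi>\<in>couplings \<mu> \<nu>. \<integral>\<^sup>+z. ennreal (d (fst z) (snd z)) \<partial>\<pi>)"

text \<open>
  The largest admissible \<open>\<sigma> \<in> [-\<infinity>, \<infinity>]\<close>, written as the supremum of the admissible real numbers:
  these form a closed, downward closed set, and the supremum is \<open>-\<infinity>\<close> if there are none.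
\<close>
definition coarse_ricci ::
  "('a \<Rightarrow> 'a \<Rightarrow> real) \<Rightarrow> (real \<Rightarrow> 'a \<Rightarrow> 'a measure) \<Rightarrow> ereal" where
  "coarse_ricci d K =
     Sup {ereal \<sigma> | \<sigma>. \<forall>t\<ge>0. \<forall>x y.
        wasserstein d (K t x) (K t y) \<le> ennreal (exp (- \<sigma> * t) * d x y)}"

text \<open>
  The discrete-time coarse Ricci curvature \<open>1 - W(P\<^sub>x, P\<^sub>y) / d(x, y)\<close> for the trivial distance, in
  its total variation form, which is also meaningful (and equal to 1) on the diagonal.  The stochastic
  matrix is given by its rows, \<open>P\<^sub>x\<^sub>y = pmf (P x) y\<close>.
\<close>
definition tv_norm :: "'e pmf \<Rightarrow> 'e pmf \<Rightarrow> real" where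
  "tv_norm p q = (\<Sum>\<^sub>\<infinity>z. \<bar>pmf p z - pmf q z\<bar>)"

definition theta :: "('e \<Rightarrow> 'e pmf) \<Rightarrow> 'e \<Rightarrow> 'e \<Rightarrow> real" where
  "theta P x y = 1 - tv_norm (P x) (P y) / 2"

text \<open>
  The supremum is taken in \<^typ>\<open>ennreal\<close>: it may be infinite, and it is 0 when there is no admissible
  pair of configurations.
\<close>
definition lip_norm :: "'e \<Rightarrow> (('n::finite \<Rightarrow> 'e) \<Rightarrow> real) \<Rightarrow> ennreal" where
  "lip_norm x g =
     (SUP (xs, ys) \<in> {(xs, ys). xs \<noteq> ys \<and> x \<in> range xs \<and> x \<in> range ys}.
        ennreal (\<bar>g xs - g ys\<bar> / config_dist xs ys))"

section \<open>Markov processes in continuous time\<close>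

text \<open>
  A time-homogeneous Markov process on a countable state space is a family \<open>(M x)\<close> of probability
  measures, \<open>M x\<close> being the law started from \<open>x\<close>, together with random variables \<open>X t\<close>, \<open>t \<ge> 0\<close>.
  The last conjunct is the Markov property, with the past observed at times
  \<open>s 0 \<le> \<dots> \<le> s n\<close>.
\<close>
definition markov_process ::
  "('a::countable \<Rightarrow> 'w measure) \<Rightarrow> (real \<Rightarrow> 'w \<Rightarrow> 'a) \<Rightarrow> bool" where
  "markov_process M X \<longleftrightarrow>
     (\<forall>x. prob_space (M x)) \<and>
     (\<forall>x. \<forall>t\<ge>0. X t \<in> M x \<rightarrow>\<^sub>M count_space UNIV) \<and>
     (\<forall>x. AE \<omega> in M x. X 0 \<omega> = x) \<and>
     (\<forall>x n (s :: nat \<Rightarrow> real) a t z. 0 \<le> s 0 \<longrightarrow> mono s \<longrightarrow> 0 \<le> t \<longrightarrow>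
        measure (M x) {\<omega> \<in> space (M x). (\<forall>k\<le>n. X (s k) \<omega> = a k) \<and> X (s n + t) \<omega> = z} =
        measure (M x) {\<omega> \<in> space (M x). \<forall>k\<le>n. X (s k) \<omega> = a k} *
        measure (M (a n)) {\<omega> \<in> space (M (a n)). X t \<omega> = z})"

definition transition_law ::
  "('a \<Rightarrow> 'w measure) \<Rightarrow> (real \<Rightarrow> 'w \<Rightarrow> 'a) \<Rightarrow> real \<Rightarrow> 'a \<Rightarrow> 'a measure" where
  "transition_law M X t x = distr (M x) (count_space UNIV) (X t)"

text \<open>
  Non-explosion: the paths are right-continuous for the discrete topology and jump only finitely often
  in every bounded time interval.
\<close>
definition nonexplosive_path :: "(real \<Rightarrow> 'a) \<Rightarrow> bool" where
  "nonexplosive_path \<xi> \<longleftrightarrow>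
     (\<forall>t\<ge>0. \<forall>\<^sub>F s in at_right t. \<xi> s = \<xi> t) \<and>
     (\<forall>T. finite {t \<in> {0<..T}. \<not> (\<forall>\<^sub>F s in at_left t. \<xi> s = \<xi> t)})"

definition nonexplosive :: "('a \<Rightarrow> 'w measure) \<Rightarrow> (real \<Rightarrow> 'w \<Rightarrow> 'a) \<Rightarrow> bool" where
  "nonexplosive M X \<longleftrightarrow> (\<forall>x. AE \<omega> in M x. nonexplosive_path (\<lambda>t. X t \<omega>))"

text \<open>
  The rates need not be bounded, so the derivative at time 0 of the semigroup on bounded functions
  is taken pointwise.
\<close>
definition has_generator ::
  "('a \<Rightarrow> 'w measure) \<Rightarrow> (real \<Rightarrow> 'w \<Rightarrow> 'a) \<Rightarrow> (('a \<Rightarrow> real) \<Rightarrow> 'a \<Rightarrow> real) \<Rightarrow> bool" where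
  "has_generator M X L \<longleftrightarrow>
     (\<forall>f x. bounded (range f) \<longrightarrow>
        ((\<lambda>t. ((\<integral>\<omega>. f (X t \<omega>) \<partial>M x) - f x) / t) \<longlongrightarrow> L f x) (at_right 0))"

definition particle_generator ::
  "('e \<Rightarrow> 'e pmf) \<Rightarrow> ('e \<Rightarrow> ('n::finite \<Rightarrow> 'e) \<Rightarrow> real) \<Rightarrow>
   (('n \<Rightarrow> 'e) \<Rightarrow> real) \<Rightarrow> ('n \<Rightarrow> 'e) \<Rightarrow> real" where
  "particle_generator P c f xs =
     (\<Sum>i\<in>UNIV. c (xs i) xs * (\<Sum>\<^sub>\<infinity>y. pmf (P (xs i)) y * (f (xs(i := y)) - f xs)))"

end

theory Submission
  imports Defs
begin

text \<open>
  It suffices to couple the laws at time \<open>t\<close> started from two given configurations at cost at most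
  \<open>exp (- r t) d + \<eta>\<close>, for every \<open>\<eta> > 0\<close>; no coupled process in continuous time and no uniqueness
  theorem for unbounded rates is needed.  Restrict the process to the times \<open>k t / m\<close>.  From two configurations
  in a finite set \<open>A\<close>, for small \<open>h\<close>, the laws at time \<open>h\<close> are within \<open>o(h)\<close> in total variation of an
  Euler step, in which a uniformly chosen coordinate jumps.  Euler steps are coupled by choosing the
  same coordinate and coupling its new values maximally, which contracts the distance by \<open>1 - r h\<close>.
  Iterating gives the estimate up to the probability of leaving \<open>A\<close> before time \<open>t\<close>, which is
  small uniformly in \<open>m\<close> for large \<open>A\<close>, because a non-explosive path visits finitely many states.
\<close>

section \<open>Maximal couplings and gluing\<close>

lemma integrable_pmf_count_space [simp]: "integrable (count_space UNIV) (pmf p)"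
  using pmf_abs_summable[of p UNIV] by (simp add: abs_summable_on_def)

lemma integral_pmf_count_space [simp]: "(\<integral>z. pmf p z \<partial>count_space UNIV) = 1"
  using infsetsum_pmf_eq_1[of p UNIV] by (simp add: infsetsum_def)

lemma integral_measure_pmf_count_space:
  "measure_pmf.expectation p f = (\<integral>z. pmf p z * f z \<partial>count_space UNIV)" for f :: "'a \<Rightarrow> real"
  by (simp add: measure_pmf_eq_density integral_density)

lemma integrable_measure_pmf_count_space:
  "integrable (measure_pmf p) f \<longleftrightarrow> integrable (count_space UNIV) (\<lambda>z. pmf p z * f z)"
  for f :: "'a \<Rightarrow> real"
  by (simp add: measure_pmf_eq_density integrable_density)

lemma integrable_pmf_bounded:
  fixes f :: "'a \<Rightarrow> real"
  assumes "\<And>z. \<bar>f z\<bar> \<le> B"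
  shows "integrable (measure_pmf p) f"
  using assms by (intro measure_pmf.integrable_const_bound[where B = B]) auto

lemma infsum_pmf_eq_expectation:
  fixes f :: "'a \<Rightarrow> real"
  assumes "\<And>z. \<bar>f z\<bar> \<le> B"
  shows "(\<Sum>\<^sub>\<infinity>z. pmf p z * f z) = measure_pmf.expectation p f"
proof -
  have "integrable (count_space UNIV) (\<lambda>z. pmf p z * f z)"
    using integrable_pmf_bounded[OF assms] by (simp add: integrable_measure_pmf_count_space)
  then show ?thesis
    by (simp add: integral_measure_pmf_count_space abs_summable_on_def infsetsum_def
        flip: infsetsum_infsum)
qed

lemma expectation_bind_pmf:
  fixes g :: "'b \<Rightarrow> real"
  assumes "\<And>z. 0 \<le> g z" "\<And>z. g z \<le> B"
  shows "measure_pmf.expectation (bind_pmf p f) g =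
    measure_pmf.expectation p (\<lambda>x. measure_pmf.expectation (f x) g)"
proof -
  have B: "0 \<le> B" using assms order_trans by blast
  have int: "integrable (measure_pmf r) g" for r
    using assms
      by (intro integrable_pmf_bounded[where B = B])
        (auto simp: abs_le_iff intro: order_trans[OF _ assms(1)])
  have le: "measure_pmf.expectation r g \<le> B" for r
    using measure_pmf.integral_le_const[OF int, of B] assms by auto
  have int': "integrable (measure_pmf p) (\<lambda>x. measure_pmf.expectation (f x) g)"
    using le assms(1)
      by (intro integrable_pmf_bounded[where B = B])
        (auto simp: abs_le_iff B intro: order_trans[OF _ B])
  have "ennreal (measure_pmf.expectation (bind_pmf p f) g) = (\<integral>\<^sup>+z. g z \<partial>bind_pmf p f)"
    using assms int by (intro nn_integral_eq_integral[symmetric]) auto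
  also have "\<dots> = (\<integral>\<^sup>+x. ennreal (measure_pmf.expectation (f x) g) \<partial>p)"
    using assms int by (simp add: nn_integral_eq_integral)
  also have "\<dots> = ennreal (measure_pmf.expectation p (\<lambda>x. measure_pmf.expectation (f x) g))"
    using assms int' by (intro nn_integral_eq_integral) auto
  finally show ?thesis using assms by (subst (asm) ennreal_inj) auto
qed

section \<open>Total variation and the maximal coupling\<close>

lemma trivial_dist_bounds [simp]:
  "0 \<le> trivial_dist u v" "trivial_dist u v \<le> 1" "trivial_dist u u = 0" "\<bar>trivial_dist u v\<bar> \<le> 1"
  by (auto simp: trivial_dist_def)

lemma tv_norm_eq_integral: "tv_norm p q = (\<integral>z. \<bar>pmf p z - pmf q z\<bar> \<partial>count_space UNIV)"
  unfolding tv_norm_def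
  by (subst infsetsum_infsum[symmetric]) (auto simp: infsetsum_def abs_summable_on_def)

text \<open>The maximal coupling, disintegrated over its first marginal: \<open>K u\<close> keeps
  \<open>u\<close> with probability min (1, q u / p u) and otherwise draws from the normalised
  excess of \<open>q\<close> over \<open>p\<close>. In kernel form it can be composed with a
  coupling that is already given.\<close>

lemma exists_maximal_kernel:
  "\<exists>K. bind_pmf p K = q \<and>
    measure_pmf.expectation p
      (\<lambda>u. measure_pmf.expectation (K u) (trivial_dist u)) \<le> tv_norm p q / 2"
proof -
  \<comment> \<open>\<open>\<mu>\<close> is the common part of the two laws, of mass
    \<open>1 - \<delta>\<close>; each law has mass \<open>\<delta>\<close> beyond it.\<close>
  define \<mu> where "\<mu> z = min (pmf p z) (pmf q z)" for z
  define \<delta> where "\<delta> = tv_norm p q / 2"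
  have int [simp]: "integrable (count_space UNIV) \<mu>"
    unfolding \<mu>_def by auto
  have \<mu>_abs: "\<mu> z = (pmf p z + pmf q z - \<bar>pmf p z - pmf q z\<bar>) / 2" for z
    by (simp add: \<mu>_def)
  have int\<mu>: "(\<integral>z. \<mu> z \<partial>count_space UNIV) = 1 - \<delta>"
    unfolding \<mu>_abs \<delta>_def tv_norm_eq_integral by (simp add: field_simps)
  have int1: "(\<integral>z. pmf p z - \<mu> z \<partial>count_space UNIV) = \<delta>"
    and int2: "(\<integral>z. pmf q z - \<mu> z \<partial>count_space UNIV) = \<delta>"
    by (simp_all add: int\<mu>)
  have nn: "0 \<le> pmf p z - \<mu> z" "0 \<le> pmf q z - \<mu> z" "0 \<le> \<mu> z" for z
    by (auto simp: \<mu>_def)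
  have \<delta>0: "0 \<le> \<delta>" using int1 nn by (metis Bochner_Integration.integral_nonneg)
  show ?thesis
  \<comment> \<open>The excess cannot be normalised when \<open>\<delta> = 0\<close>; the laws then
    agree and the identity kernel serves.\<close>
  proof (cases "\<delta> = 0")
    case True
    have "AE z in count_space UNIV. pmf p z - \<mu> z = 0"
      using int1 nn True by (subst integral_nonneg_eq_0_iff_AE[symmetric]) auto
    moreover have "AE z in count_space UNIV. pmf q z - \<mu> z = 0"
      using int2 nn True by (subst integral_nonneg_eq_0_iff_AE[symmetric]) auto
    ultimately have "p = q" by (intro pmf_eqI) (simp add: AE_count_space)
    with True show ?thesis
      by (intro exI[of _ return_pmf]) (auto simp: bind_return_pmf' \<delta>_def)
  next
    case False
    with \<delta>0 have \<delta>: "0 < \<delta>" by simp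
    define r where "r z = (pmf q z - \<mu> z) / \<delta>" for z
    define R where "R = embed_pmf r"
    have "(\<integral>\<^sup>+z. ennreal (r z) \<partial>count_space UNIV) = ennreal (\<integral>z. r z \<partial>count_space UNIV)"
      unfolding r_def using nn \<delta> by (intro nn_integral_eq_integral) auto
    also have "(\<integral>z. r z \<partial>count_space UNIV) = 1"
      unfolding r_def using int2 \<delta> by simp
    finally have R: "pmf R z = r z" for z
      unfolding R_def using nn \<delta> by (intro pmf_embed_pmf) (auto simp: r_def)
    \<comment> \<open>Division by zero returns 0, so \<open>pmf p z * m z = \<mu> z\<close> also
      holds where \<open>p\<close> vanishes.\<close>
    define m where "m z = min 1 (pmf q z / pmf p z)" for z
    have m: "0 \<le> m z" "m z \<le> 1" "pmf p z * m z = \<mu> z" for z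
      using pmf_nonneg[of p z] pmf_nonneg[of q z]
      by (auto simp: m_def \<mu>_def min_def field_simps split: if_splits)
    define K where "K z = bind_pmf (bernoulli_pmf (m z)) (\<lambda>b. if b then return_pmf z else R)" for z
    have pmfK: "pmf (K z) w = indicator {w} z * m z + r w * (1 - m z)" for z w
      using m(1,2)[of z] by (simp add: K_def pmf_bind R)
    have "pmf (bind_pmf p K) w = pmf q w" for w
    proof -
      have "pmf (bind_pmf p K) w =
        (\<integral>z. pmf p z * (indicator {w} z * m z + r w * (1 - m z)) \<partial>count_space UNIV)"
        by (simp add: pmf_bind pmfK integral_measure_pmf_count_space)
      \<comment> \<open>The kept mass at \<open>w\<close> is \<open>\<mu> w\<close>; the moved mass,
        \<open>\<delta>\<close> in total, is redistributed according to \<open>r\<close>.\<close>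
      also have "\<dots> = (\<integral>z. \<mu> w * indicator {w} z + r w * (pmf p z - \<mu> z) \<partial>count_space UNIV)"
        by (intro Bochner_Integration.integral_cong refl)
          (auto simp: m(3)[symmetric] algebra_simps indicator_def)
      also have "\<dots> = \<mu> w + r w * \<delta>"
        using int1 by (subst Bochner_Integration.integral_add) (auto simp: int\<mu>)
      also have "\<dots> = pmf q w" using \<delta> by (simp add: r_def)
      finally show ?thesis .
    qed
    then have "bind_pmf p K = q" by (intro pmf_eqI)
    moreover have "measure_pmf.expectation p
      (\<lambda>u. measure_pmf.expectation (K u) (trivial_dist u)) \<le> \<delta>"
    proof -
      have K': "measure_pmf.expectation (K u) (trivial_dist u) \<le> 1 - m u" for u
      proof -
        have "measure_pmf.expectation (K u) (trivial_dist u) =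
          (1 - m u) * measure_pmf.expectation R (trivial_dist u)"
          unfolding K_def using m(1,2)[of u] by (subst expectation_bind_pmf[where B = 1]) auto
        also have "\<dots> \<le> (1 - m u) * 1"
          using m(2)[of u]
            by (intro mult_left_mono measure_pmf.integral_le_const integrable_pmf_bounded[where B = 1])
              auto
        finally show ?thesis by simp
      qed
      have "measure_pmf.expectation p (\<lambda>u. measure_pmf.expectation (K u) (trivial_dist u))
          \<le> measure_pmf.expectation p (\<lambda>u. 1 - m u)"
        using K' m by (intro integral_mono integrable_pmf_bounded[where B = 1])
          (auto simp: abs_le_iff intro: order_trans[OF K'] order_trans[of _ 0])
      also have "\<dots> = (\<integral>z. pmf p z - \<mu> z \<partial>count_space UNIV)"
        unfolding integral_measure_pmf_count_space
        by (intro Bochner_Integration.integral_cong refl) (simp add: m(3)[symmetric] algebra_simps)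
      finally show ?thesis by (simp add: int1 int\<mu>)
    qed
    ultimately show ?thesis by (auto simp: \<delta>_def)
  qed
qed

text \<open>Write |p - q| = (p - q) + 2 max (0, q - p). The first term sums to 0, and the positive
  part of q - p is at most |p - q| on \<open>F\<close> and at most \<open>q\<close> off
  \<open>F\<close>. This is why the tail of only one of the two laws enters.\<close>

lemma tv_norm_le:
  assumes "finite F"
  shows "tv_norm p q \<le> 2 * ((\<Sum>z\<in>F. \<bar>pmf p z - pmf q z\<bar>) + measure_pmf.prob q (- F))"
proof -
  let ?g = "\<lambda>z. (pmf p z - pmf q z) + 2 * (\<Sum>y\<in>F. \<bar>pmf p y - pmf q y\<bar> * indicator {y} z) +
    2 * (pmf q z * indicator (- F) z)"
  have i: "integrable (count_space UNIV) (\<lambda>z. pmf q z * indicator (- F) z)"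
    unfolding integrable_measure_pmf_count_space[symmetric]
      by (rule integrable_pmf_bounded[of _ 1]) auto
  have "tv_norm p q \<le> (\<integral>z. ?g z \<partial>count_space UNIV)"
    unfolding tv_norm_eq_integral
  proof (rule integral_mono)
    fix z
    have "(\<Sum>y\<in>F. \<bar>pmf p y - pmf q y\<bar> * indicator {y} z) =
      (\<Sum>y\<in>F. if y = z then \<bar>pmf p z - pmf q z\<bar> else 0)"
      by (intro sum.cong) auto
    then have "(\<Sum>y\<in>F. \<bar>pmf p y - pmf q y\<bar> * indicator {y} z) =
      (if z \<in> F then \<bar>pmf p z - pmf q z\<bar> else 0)"
      using assms by simp
    then show "\<bar>pmf p z - pmf q z\<bar> \<le> ?g z"
      using pmf_nonneg[of p z] pmf_nonneg[of q z] by (cases "z \<in> F") (auto simp: abs_if)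
  qed (use i in auto)
  also have "\<dots> = 2 * (\<Sum>z\<in>F. \<bar>pmf p z - pmf q z\<bar>) +
    2 * (\<integral>z. pmf q z * indicator (- F) z \<partial>count_space UNIV)"
    using i by simp
  also have "(\<integral>z. pmf q z * indicator (- F) z \<partial>count_space UNIV) = measure_pmf.prob q (- F)"
    by (simp add: integral_measure_pmf_count_space[symmetric])
  finally show ?thesis by simp
qed

lemma tv_norm_commute: "tv_norm p q = tv_norm q p"
  unfolding tv_norm_def by (simp add: abs_minus_commute)

lemma finite_to_nat_le: "finite {z :: 'a::countable. to_nat z \<le> n}"
  by (rule finite_imageD[of to_nat])
    (auto intro: finite_subset[of _ "{..n}"] inj_on_subset[OF inj_to_nat])

lemma exists_finite_prob_Compl_less:
  fixes p :: "'a::countable pmf"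
  assumes "0 < \<epsilon>"
  shows "\<exists>F. finite F \<and> measure_pmf.prob p (- F) < \<epsilon>"
proof -
  define F where "F n = {z :: 'a. to_nat z \<le> n}" for n
  have F: "finite (F n)" for n
    unfolding F_def by (rule finite_to_nat_le)
  have "(\<lambda>n. measure_pmf.prob p (F n)) \<longlonglongrightarrow> measure_pmf.prob p (\<Union>n. F n)"
    by (intro measure_pmf.finite_Lim_measure_incseq) (auto simp: incseq_def F_def)
  moreover have "(\<Union>n. F n) = UNIV" by (auto simp: F_def)
  ultimately have "\<forall>\<^sub>F n in sequentially. 1 - \<epsilon> < measure_pmf.prob p (F n)"
    using assms by (intro order_tendstoD) auto
  then obtain n where "1 - \<epsilon> < measure_pmf.prob p (F n)" by (auto simp: eventually_sequentially)
  then show ?thesis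
    using F measure_pmf.prob_compl[of "F n" p]
      by (intro exI[of _ "F n"]) (auto simp: Compl_eq_Diff_UNIV)
qed

text \<open>Couplings are kept as pmfs, so that they can be composed by \<open>bind_pmf\<close>;
  \<open>wasserstein_le_cost\<close> returns to the measures in \<open>couplings\<close>.\<close>

definition is_coupling :: "('a \<times> 'b) pmf \<Rightarrow> 'a pmf \<Rightarrow> 'b pmf \<Rightarrow> bool" where
  "is_coupling \<pi> p q \<longleftrightarrow> map_pmf fst \<pi> = p \<and> map_pmf snd \<pi> = q"

abbreviation cost :: "('a \<Rightarrow> 'b \<Rightarrow> real) \<Rightarrow> ('a \<times> 'b) pmf \<Rightarrow> real" where
  "cost d \<pi> \<equiv> measure_pmf.expectation \<pi> (\<lambda>z. d (fst z) (snd z))"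

text \<open>Countability makes the product sigma-algebra discrete, so a joint pmf is an admissible
  coupling of the two measures.\<close>

lemma wasserstein_le_cost:
  fixes \<pi> :: "('a::countable \<times> 'a) pmf"
  assumes "is_coupling \<pi> p q" "\<And>x y. 0 \<le> d x y" "\<And>x y. d x y \<le> 1"
  shows "wasserstein d (measure_pmf p) (measure_pmf q) \<le> ennreal (cost d \<pi>)"
proof -
  have "distr (measure_pmf \<pi>) (measure_pmf p) fst = measure_pmf (map_pmf fst \<pi>)"
    "distr (measure_pmf \<pi>) (measure_pmf q) snd = measure_pmf (map_pmf snd \<pi>)"
    unfolding map_pmf_rep_eq by (auto intro: distr_cong)
  moreover have "sets (measure_pmf p \<Otimes>\<^sub>M measure_pmf q) = UNIV"
  proof -
    have "sets (measure_pmf p \<Otimes>\<^sub>M measure_pmf q) =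
      sets (count_space (UNIV :: 'a set) \<Otimes>\<^sub>M count_space (UNIV :: 'a set))"
      by (intro sets_pair_measure_cong) auto
    also have "count_space (UNIV :: 'a set) \<Otimes>\<^sub>M count_space (UNIV :: 'a set) =
      count_space (UNIV \<times> UNIV)"
      by (rule pair_measure_countable) auto
    finally show ?thesis by simp
  qed
  ultimately have "measure_pmf \<pi> \<in> couplings (measure_pmf p) (measure_pmf q)"
    using assms(1) by (auto simp: couplings_def is_coupling_def)
  then have "wasserstein d (measure_pmf p) (measure_pmf q) \<le> (\<integral>\<^sup>+z. ennreal (d (fst z) (snd z)) \<partial>\<pi>)"
    unfolding wasserstein_def by (rule INF_lower)
  also have "\<dots> = ennreal (cost d \<pi>)"
    using assms
    by (intro nn_integral_eq_integral integrable_pmf_bounded[of _ 1]) auto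
  finally show ?thesis .
qed

text \<open>Draw a pair from \<open>\<pi>\<close> and correct each component by a maximal kernel. By
  \<open>tri\<close> a correction raises \<open>d\<close> by at most the indicator that the
  component moved, whose mean is at most half the total variation norm.\<close>

lemma glue_coupling:
  assumes d: "\<And>x y. 0 \<le> d x y" "\<And>x y. d x y \<le> 1"
    and tri: "\<And>x y x' y'. d x' y' \<le> d x y + trivial_dist x x' + trivial_dist y y'"
    and \<pi>: "is_coupling \<pi> p q"
  shows "\<exists>\<pi>'. is_coupling \<pi>' p' q' \<and> cost d \<pi>' \<le> cost d \<pi> + tv_norm p p' / 2 + tv_norm q q' / 2"
proof -
  obtain K where K: "bind_pmf p K = p'"
    "measure_pmf.expectation p
      (\<lambda>u. measure_pmf.expectation (K u) (trivial_dist u)) \<le> tv_norm p p' / 2"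
    using exists_maximal_kernel by blast
  obtain H where H: "bind_pmf q H = q'"
    "measure_pmf.expectation q
      (\<lambda>u. measure_pmf.expectation (H u) (trivial_dist u)) \<le> tv_norm q q' / 2"
    using exists_maximal_kernel by blast
  have p: "p = map_pmf fst \<pi>" and q: "q = map_pmf snd \<pi>" using \<pi> by (auto simp: is_coupling_def)
  \<comment> \<open>Given the pair, the corrections are independent; only their separate
    displacement probabilities enter the cost.\<close>
  define G where "G z = pair_pmf (K (fst z)) (H (snd z))" for z
  have "is_coupling (bind_pmf \<pi> G) p' q'"
    unfolding is_coupling_def K(1)[symmetric] H(1)[symmetric] p q
    by (simp add: map_bind_pmf bind_map_pmf G_def map_fst_pair_pmf map_snd_pair_pmf)
  moreover have "cost d (bind_pmf \<pi> G) \<le> cost d \<pi> + tv_norm p p' / 2 + tv_norm q q' / 2"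
  proof -
    let ?k = "\<lambda>z. measure_pmf.expectation (K z) (trivial_dist z)"
    let ?h = "\<lambda>z. measure_pmf.expectation (H z) (trivial_dist z)"
    have E01:
      "0 \<le> measure_pmf.expectation r f" "measure_pmf.expectation r f \<le> 1"
      "integrable (measure_pmf r) f"
      if "\<And>z. 0 \<le> f z" "\<And>z. f z \<le> 1" for r :: "'x pmf" and f :: "'x \<Rightarrow> real"
    proof -
      show "integrable (measure_pmf r) f"
        by (rule integrable_pmf_bounded[of _ 1]) (simp add: abs_of_nonneg that)
      then show "0 \<le> measure_pmf.expectation r f" "measure_pmf.expectation r f \<le> 1"
        using that by (auto intro: measure_pmf.integral_le_const)
    qed
    have inner: "cost d (G z) \<le> d (fst z) (snd z) + ?k (fst z) + ?h (snd z)" for z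
    proof -
      have "cost d (G z) \<le> measure_pmf.expectation (G z)
          (\<lambda>y. d (fst z) (snd z) + trivial_dist (fst z) (fst y) + trivial_dist (snd z) (snd y))"
        using tri d by (intro integral_mono Bochner_Integration.integrable_add) (auto intro: E01)
      also have "\<dots> = d (fst z) (snd z) + measure_pmf.expectation (G z)
          (\<lambda>y. trivial_dist (fst z) (fst y)) + measure_pmf.expectation (G z) (\<lambda>y. trivial_dist (snd z) (snd y))"
        by (simp add: E01 measure_pmf.prob_space)
      also have "measure_pmf.expectation (G z) (\<lambda>y. trivial_dist (fst z) (fst y)) = ?k (fst z)"
        by (simp add: G_def integral_map_pmf[of fst, symmetric] map_fst_pair_pmf del: integral_map_pmf)
      also have "measure_pmf.expectation (G z) (\<lambda>y. trivial_dist (snd z) (snd y)) = ?h (snd z)"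
        by (simp add: G_def integral_map_pmf[of snd, symmetric] map_snd_pair_pmf del: integral_map_pmf)
      finally show ?thesis .
    qed
    have "cost d (bind_pmf \<pi> G) = measure_pmf.expectation \<pi> (\<lambda>z. cost d (G z))"
      using d by (intro expectation_bind_pmf[of _ 1]) auto
    also have "\<dots> \<le> measure_pmf.expectation \<pi> (\<lambda>z. d (fst z) (snd z) + ?k (fst z) + ?h (snd z))"
      using d inner by (intro integral_mono Bochner_Integration.integrable_add) (auto intro!: E01)
    also have "\<dots> = cost d \<pi> + measure_pmf.expectation \<pi> (\<lambda>z. ?k (fst z)) +
      measure_pmf.expectation \<pi> (\<lambda>z. ?h (snd z))"
      using d by (simp add: E01)
    also have "measure_pmf.expectation \<pi> (\<lambda>z. ?k (fst z)) = measure_pmf.expectation p ?k"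
      by (simp add: p)
    also have "measure_pmf.expectation \<pi> (\<lambda>z. ?h (snd z)) = measure_pmf.expectation q ?h"
      by (simp add: q)
    finally show ?thesis using K H by simp
  qed
  ultimately show ?thesis by blast
qed

section \<open>Skeletons of a non-explosive Markov process\<close>

text \<open>Compactness: every time in the interval has a neighbourhood on which the path takes at
  most three values, and finitely many such neighbourhoods cover.\<close>

lemma nonexplosive_path_finite_range:
  assumes "nonexplosive_path \<xi>"
  shows "finite (\<xi> ` {0..T})"
proof -
  define J where "J = {t \<in> {0<..T}. \<not> (\<forall>\<^sub>F s in at_left t. \<xi> s = \<xi> t)}"
  have J: "finite J" and right: "\<And>t. 0 \<le> t \<Longrightarrow> \<forall>\<^sub>F s in at_right t. \<xi> s = \<xi> t"
    using assms by (auto simp: nonexplosive_path_def J_def)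
  \<comment> \<open>Without jumps the path is locally constant on the open interval, hence constant
    by connectedness.\<close>
  have const: "\<xi> constant_on {a<..<b}" if ab: "0 \<le> a" "b \<le> T" "{a<..<b} \<inter> J = {}" for a b
  proof (rule locally_constant_imp_constant)
    fix t assume t: "t \<in> {a<..<b}"
    then have "t \<notin> J" "t \<in> {0<..T}" using ab by auto
    then have "\<forall>\<^sub>F s in at_left t. \<xi> s = \<xi> t" by (simp add: J_def)
    moreover have "\<forall>\<^sub>F s in at_right t. \<xi> s = \<xi> t" using right t ab by auto
    ultimately have "\<forall>\<^sub>F s in at t. \<xi> s = \<xi> t" by (simp add: eventually_at_split)
    then obtain S where S: "open S" "t \<in> S" "\<forall>s\<in>S. s \<noteq> t \<longrightarrow> \<xi> s = \<xi> t"
      unfolding eventually_at_topological by auto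
    then show "\<exists>S. openin (top_of_set {a<..<b}) S \<and> t \<in> S \<and> (\<forall>s\<in>S. \<xi> s = \<xi> t)"
      using t by (intro exI[of _ "{a<..<b} \<inter> S"]) (use S in \<open>auto simp: openin_open\<close>)
  qed (simp add: connected_Ioo)
  have "\<exists>U. open U \<and> t \<in> U \<and> finite (\<xi> ` (U \<inter> {0..T}))" if t: "t \<in> {0..T}" for t
  proof -
    obtain b where b: "t < b" "\<And>s. t < s \<Longrightarrow> s < b \<Longrightarrow> \<xi> s = \<xi> t"
      using right[of t] t by (auto simp: eventually_at_right_field)
    have "\<forall>\<^sub>F s in at_left t. s \<notin> J"
      using islimpt_finite[OF J] by (auto simp: islimpt_iff_eventually eventually_at_split)
    then obtain a where a: "a < t" "\<And>s. a < s \<Longrightarrow> s < t \<Longrightarrow> s \<notin> J"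
      by (auto simp: eventually_at_left_field)
    have "\<xi> constant_on {max a 0<..<t}"
      using a t by (intro const) (auto simp: disjoint_iff)
    then obtain v where v: "\<And>s. s \<in> {max a 0<..<t} \<Longrightarrow> \<xi> s = v"
      by (auto simp: constant_on_def)
    \<comment> \<open>The value \<open>v\<close> is only known at positive times before
      \<open>t\<close>, so time 0 contributes its own value.\<close>
    have "\<xi> s \<in> {\<xi> 0, v, \<xi> t}" if s: "s \<in> {a<..<b} \<inter> {0..T}" for s
    proof -
      consider "s = 0" | "s = t" | "t < s" | "0 < s" "s < t" using s by force
      then show ?thesis using v[of s] b(2)[of s] s by cases auto
    qed
    then have "\<xi> ` ({a<..<b} \<inter> {0..T}) \<subseteq> {\<xi> 0, v, \<xi> t}" by blast
    then have "finite (\<xi> ` ({a<..<b} \<inter> {0..T}))" using finite_subset by blast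
    then show ?thesis using a b by (intro exI[of _ "{a<..<b}"]) auto
  qed
  then obtain U where U: "\<And>t. t \<in> {0..T} \<Longrightarrow> open (U t) \<and> t \<in> U t \<and> finite (\<xi> ` (U t \<inter> {0..T}))"
    by metis
  obtain D where D: "D \<subseteq> {0..T}" "finite D" "{0..T} \<subseteq> (\<Union>t\<in>D. U t)"
    using compactE_image[OF compact_Icc[of 0 T], of "{0..T}" U] U by blast
  have "finite (\<Union>t\<in>D. \<xi> ` (U t \<inter> {0..T}))" using D U by blast
  moreover have "\<xi> ` {0..T} \<subseteq> (\<Union>t\<in>D. \<xi> ` (U t \<inter> {0..T}))" using D(3) by blast
  ultimately show ?thesis by (rule finite_subset[rotated])
qed

section \<open>Transition laws and the Chapman-Kolmogorov equation\<close>

locale countable_markov =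
  fixes M :: "'a::countable \<Rightarrow> 'w measure" and X :: "real \<Rightarrow> 'w \<Rightarrow> 'a"
  assumes markov: "markov_process M X"
begin

lemma prob_space_M [simp]: "prob_space (M x)"
  using markov by (simp add: markov_process_def)

lemma measurable_X [measurable]: "0 \<le> t \<Longrightarrow> X t \<in> M x \<rightarrow>\<^sub>M count_space UNIV"
  using markov by (simp add: markov_process_def)

lemma AE_X_0: "AE \<omega> in M x. X 0 \<omega> = x"
  using markov by (simp add: markov_process_def)

lemma sets_X [measurable]: "0 \<le> t \<Longrightarrow> {\<omega> \<in> space (M x). X t \<omega> \<in> A} \<in> sets (M x)"
  by measurable

lemma markov_property:
  fixes s :: "nat \<Rightarrow> real" and n :: nat
  assumes "0 \<le> s 0" "mono s" "0 \<le> t"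
  shows "measure (M x) {\<omega> \<in> space (M x). (\<forall>k\<le>n. X (s k) \<omega> = a k) \<and> X (s n + t) \<omega> = z} =
    measure (M x) {\<omega> \<in> space (M x). \<forall>k\<le>n. X (s k) \<omega> = a k} *
    measure (M (a n)) {\<omega> \<in> space (M (a n)). X t \<omega> = z}"
  using markov assms unfolding markov_process_def by blast

text \<open>Only meaningful for \<open>t \<ge> 0\<close>.\<close>
definition trans_pmf :: "real \<Rightarrow> 'a \<Rightarrow> 'a pmf" where
  "trans_pmf t x = embed_pmf (\<lambda>z. measure (M x) {\<omega> \<in> space (M x). X t \<omega> = z})"

lemma pmf_trans_pmf:
  assumes "0 \<le> t"
  shows "pmf (trans_pmf t x) z = measure (M x) {\<omega> \<in> space (M x). X t \<omega> = z}"
  unfolding trans_pmf_def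
proof (rule pmf_embed_pmf)
  interpret prob_space "M x" by simp
  have [measurable]: "X t \<in> M x \<rightarrow>\<^sub>M count_space UNIV" using assms by simp
  have eq: "{\<omega> \<in> space (M x). X t \<omega> = z} = X t -` {z} \<inter> space (M x)" for z by auto
  have "(\<integral>\<^sup>+z. ennreal (measure (M x) {\<omega> \<in> space (M x). X t \<omega> = z}) \<partial>count_space UNIV) =
    (\<integral>\<^sup>+z. emeasure (distr (M x) (count_space UNIV) (X t)) {z} \<partial>count_space UNIV)"
    by (intro nn_integral_cong) (simp add: emeasure_distr eq emeasure_eq_measure)
  also have "\<dots> = emeasure (distr (M x) (count_space UNIV) (X t)) UNIV"
    by (subst emeasure_countable_singleton[symmetric]) auto
  also have "\<dots> = 1" by (subst emeasure_distr) (auto simp: emeasure_space_1)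
  finally show "(\<integral>\<^sup>+z. ennreal (measure (M x) {\<omega> \<in> space (M x). X t \<omega> = z}) \<partial>count_space UNIV) =
    1" .
qed simp

lemma transition_law_eq:
  assumes "0 \<le> t"
  shows "transition_law M X t x = measure_pmf (trans_pmf t x)"
proof (rule measure_eqI_countable[of _ UNIV])
  interpret prob_space "M x" by simp
  fix z
  have [measurable]: "X t \<in> M x \<rightarrow>\<^sub>M count_space UNIV" using assms by simp
  have eq: "{\<omega> \<in> space (M x). X t \<omega> = z} = X t -` {z} \<inter> space (M x)" by auto
  show "emeasure (transition_law M X t x) {z} = emeasure (measure_pmf (trans_pmf t x)) {z}"
    using assms
      by (simp add: transition_law_def emeasure_distr emeasure_pmf_single pmf_trans_pmf eq emeasure_eq_measure)
qed (auto simp: transition_law_def)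

lemma trans_pmf_0: "trans_pmf 0 x = return_pmf x"
proof (rule pmf_eqI)
  interpret prob_space "M x" by simp
  fix z
  have "measure (M x) {\<omega> \<in> space (M x). X 0 \<omega> = z} = measure (M x) {\<omega> \<in> space (M x). x = z}"
    using AE_X_0[of x]
      by (intro finite_measure_eq_AE) (auto simp: pred_def intro: sets_X[of 0 x "{z}", simplified])
  then show "pmf (trans_pmf 0 x) z = pmf (return_pmf x) z"
    by (cases "x = z") (simp_all add: pmf_trans_pmf prob_space.prob_space)
qed

text \<open>The Chapman-Kolmogorov equation: the Markov property with a single observation time
  (\<open>n = 0\<close>, constant time sequence), summed over the countably many values of
  \<open>X s\<close>.\<close>

lemma trans_pmf_add:
  assumes "0 \<le> s" "0 \<le> t"
  shows "trans_pmf (s + t) x = bind_pmf (trans_pmf s x) (trans_pmf t)"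
proof (rule pmf_eqI)
  interpret prob_space "M x" by simp
  fix z
  have [measurable]: "X s \<in> M x \<rightarrow>\<^sub>M count_space UNIV" "X (s + t) \<in> M x \<rightarrow>\<^sub>M count_space UNIV"
    using assms by auto
  let ?E = "\<lambda>a. {\<omega> \<in> space (M x). X s \<omega> = a \<and> X (s + t) \<omega> = z}"
  have E: "measure (M x) (?E a) = pmf (trans_pmf s x) a * pmf (trans_pmf t a) z" for a
    using markov_property[of "\<lambda>_. s" t x 0 "\<lambda>_. a" z] assms
    unfolding pmf_trans_pmf[OF assms(1)] pmf_trans_pmf[OF assms(2)] le_zero_eq simp_thms
      by (simp add: mono_def)
  have "ennreal (pmf (trans_pmf (s + t) x) z) = emeasure (M x) (\<Union>a\<in>UNIV. ?E a)"
  proof -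
    have "(\<Union>a\<in>UNIV. ?E a) = {\<omega> \<in> space (M x). X (s + t) \<omega> = z}" by auto
    then show ?thesis using assms by (simp add: pmf_trans_pmf emeasure_eq_measure)
  qed
  also have "\<dots> = (\<integral>\<^sup>+a. emeasure (M x) (?E a) \<partial>count_space UNIV)"
    by (rule emeasure_UN_countable) (auto simp: disjoint_family_on_def)
  also have "\<dots> =
    (\<integral>\<^sup>+a. ennreal (pmf (trans_pmf s x) a) * ennreal (pmf (trans_pmf t a) z) \<partial>count_space UNIV)"
    by (simp add: emeasure_eq_measure E ennreal_mult)
  also have "\<dots> = ennreal (pmf (bind_pmf (trans_pmf s x) (trans_pmf t)) z)"
    by (simp add: ennreal_pmf_bind measure_pmf_eq_density nn_integral_density)
  finally show "pmf (trans_pmf (s + t) x) z = pmf (bind_pmf (trans_pmf s x) (trans_pmf t)) z"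
    by simp
qed

section \<open>Remaining in a finite set along a time grid\<close>

text \<open>For finite \<open>A\<close>, \<open>stay_eq\<close> identifies this with the probability
  that the process is in \<open>A\<close> at the times 0, h, ..., k h. The recursion conditions on
  the first step, as the induction in \<open>iterate_coupling\<close> does.\<close>

primrec stay :: "real \<Rightarrow> 'a set \<Rightarrow> nat \<Rightarrow> 'a \<Rightarrow> real" where
  "stay h A 0 x = indicator A x"
| "stay h A (Suc k) x = indicator A x * measure_pmf.expectation (trans_pmf h x) (stay h A k)"

lemma stay_outside: "x \<notin> A \<Longrightarrow> stay h A k x = 0"
  by (cases k) auto

lemma stay_bounds: "0 \<le> stay h A k x" "stay h A k x \<le> 1"
proof -
  have "\<forall>x. 0 \<le> stay h A k x \<and> stay h A k x \<le> 1"
  proof (induction k)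
    case (Suc k)
    then have "measure_pmf.expectation (trans_pmf h x) (stay h A k) \<le> 1" for x
      by (intro measure_pmf.integral_le_const integrable_pmf_bounded[where B = 1]) auto
    with Suc show ?case by (auto simp: indicator_def intro: Bochner_Integration.integral_nonneg)
  qed auto
  then show "0 \<le> stay h A k x" "stay h A k x \<le> 1" by auto
qed

text \<open>The Markov property is stated for fully specified pasts. Since \<open>A\<close> is
  finite, the event is a finite disjoint union of such pasts, namely the grid paths in
  \<open>A\<close> that end at \<open>a\<close>.\<close>

lemma markov_property_set:
  fixes h :: real
  assumes "0 \<le> h" "finite A"
  shows "measure (M x) {\<omega> \<in> space (M x). (\<forall>j\<le>k. X (real j * h) \<omega> \<in> A) \<and> X (real k * h) \<omega> = a \<and>
    X (real (Suc k) * h) \<omega> = z} =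
    measure (M x) {\<omega> \<in> space (M x). (\<forall>j\<le>k. X (real j * h) \<omega> \<in> A) \<and>
      X (real k * h) \<omega> = a} * pmf (trans_pmf h a) z"
proof -
  interpret prob_space "M x" by simp
  \<comment> \<open>Extensional functions on the grid indices represent each path once, which makes
    the events disjoint.\<close>
  define W where "W = {w \<in> {..k} \<rightarrow>\<^sub>E A. w k = a}"
  have "finite ({..k} \<rightarrow>\<^sub>E A)" using assms by (intro finite_PiE) auto
  then have W: "finite W" unfolding W_def by (rule rev_finite_subset) auto
  define path where "path w \<omega> \<longleftrightarrow> (\<forall>j\<le>k. X (real j * h) \<omega> = w j)" for w \<omega>
  define Z where "Z \<omega> \<longleftrightarrow> X (real k * h + h) \<omega> = z" for \<omega>
  have [measurable]: "X (real j * h) \<in> M x \<rightarrow>\<^sub>M count_space UNIV"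
    "X (real k * h + h) \<in> M x \<rightarrow>\<^sub>M count_space UNIV" for j using assms by simp_all
  let ?G = "\<lambda>w. {\<omega> \<in> space (M x). path w \<omega>}"
  let ?F = "\<lambda>w. {\<omega> \<in> space (M x). path w \<omega> \<and> Z \<omega>}"
  have m: "?G w \<in> sets (M x)" "?F w \<in> sets (M x)" for w
    unfolding path_def Z_def by measurable
  have "w = w'" if "w \<in> W" "w' \<in> W" "path w \<omega>" "path w' \<omega>" for w w' \<omega>
    using that unfolding W_def path_def by (intro PiE_ext[of w "{..k}" "\<lambda>_. A"]) auto
  then have disj: "disjoint_family_on ?G W" "disjoint_family_on ?F W"
    unfolding disjoint_family_on_def by blast+
  have ex_path: "(\<forall>j\<le>k. X (real j * h) \<omega> \<in> A) \<and> X (real k * h) \<omega> = a \<longleftrightarrow> (\<exists>w\<in>W. path w \<omega>)" for \<omega>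
  proof
    assume "(\<forall>j\<le>k. X (real j * h) \<omega> \<in> A) \<and> X (real k * h) \<omega> = a"
    then show "\<exists>w\<in>W. path w \<omega>"
      by (intro bexI[of _ "restrict (\<lambda>j. X (real j * h) \<omega>) {..k}"]) (simp_all add: W_def path_def)
  qed (auto simp: W_def path_def PiE_iff)
  have Suc_k: "X (real (Suc k) * h) \<omega> = z \<longleftrightarrow> Z \<omega>" for \<omega> by (simp add: Z_def algebra_simps)
  have "measure (M x) {\<omega> \<in> space (M x). (\<forall>j\<le>k. X (real j * h) \<omega> \<in> A) \<and> X (real k * h) \<omega> = a \<and>
    X (real (Suc k) * h) \<omega> = z}
      = measure (M x) (\<Union>w\<in>W. ?F w)"
    unfolding Suc_k conj_assoc[symmetric] ex_path
      by (intro arg_cong[where f = "measure (M x)"]) blast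
  also have "\<dots> = (\<Sum>w\<in>W. measure (M x) (?F w))"
    using m disj W by (intro finite_measure_finite_Union) auto
  also have "\<dots> = (\<Sum>w\<in>W. measure (M x) (?G w) * pmf (trans_pmf h a) z)"
  proof (intro sum.cong refl)
    fix w assume "w \<in> W"
    then have "w k = a" by (simp add: W_def)
    moreover have "mono (\<lambda>j. real j * h)" using assms by (simp add: mono_def mult_right_mono)
    ultimately show "measure (M x) (?F w) = measure (M x) (?G w) * pmf (trans_pmf h a) z"
      using markov_property[of "\<lambda>j. real j * h" h x k w z] assms
      by (simp add: pmf_trans_pmf[OF assms(1)] path_def Z_def)
  qed
  also have "\<dots> = measure (M x) (\<Union>w\<in>W. ?G w) * pmf (trans_pmf h a) z"
    unfolding sum_distrib_right[symmetric] using m disj W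
      by (subst finite_measure_finite_Union) auto
  also have "(\<Union>w\<in>W. ?G w) = {\<omega> \<in> space (M x). (\<forall>j\<le>k. X (real j * h) \<omega> \<in> A) \<and> X (real k * h) \<omega> = a}"
    unfolding ex_path by blast
  finally show ?thesis .
qed

text \<open>The recursion for \<open>stay\<close> peels off the first step, whereas the Markov
  property appends a last one. The two are reconciled by duality between the killed transition
  operator \<open>T\<close> and the law \<open>b k\<close> of the killed skeleton after
  \<open>k\<close> steps.\<close>

lemma stay_eq:
  fixes h :: real
  assumes "0 \<le> h" "finite A"
  shows "stay h A k x = measure (M x) {\<omega> \<in> space (M x). \<forall>j\<le>k. X (real j * h) \<omega> \<in> A}"
proof -
  interpret prob_space "M x" by simp
  have [measurable]: "X (real j * h) \<in> M x \<rightarrow>\<^sub>M count_space UNIV" for j using assms by simp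
  define T :: "('a \<Rightarrow> real) \<Rightarrow> 'a \<Rightarrow> real" where
    "T f a = indicator A a * measure_pmf.expectation (trans_pmf h a) f" for f a
  have stayT: "stay h A k = (T ^^ k) (indicator A)" for k
  proof (induction k)
    case (Suc k)
    have "stay h A (Suc k) = T (stay h A k)" by (intro ext) (simp add: T_def)
    then show ?case by (simp add: Suc)
  qed auto
  define st where "st k \<omega> \<longleftrightarrow> (\<forall>j\<le>k. X (real j * h) \<omega> \<in> A)" for k and \<omega>
  have st_Suc: "st (Suc k) \<omega> \<longleftrightarrow> st k \<omega> \<and> X (real (Suc k) * h) \<omega> \<in> A" for k \<omega>
    unfolding st_def by (auto simp: le_Suc_eq simp del: of_nat_Suc)
  have st_A: "X (real k * h) \<omega> \<in> A" if "st k \<omega>" for k \<omega>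
    using that by (simp add: st_def)
  have X_sets: "{\<omega> \<in> space (M x). X (real k * h) \<omega> = a} \<in> sets (M x)" for k a
    using sets_X[of "real k * h" x "{a}"] assms by simp
  have st_sets: "{\<omega> \<in> space (M x). st k \<omega>} \<in> sets (M x)" for k
    unfolding st_def using assms
    by (intro sets.sets_Collect_countable_All sets.sets_Collect_imp sets.sets_Collect_const sets_X) simp
  define b where "b k a = measure (M x) {\<omega> \<in> space (M x). st k \<omega> \<and> X (real k * h) \<omega> = a}" for k a
  have b_Suc: "b (Suc k) z = indicator A z * (\<Sum>a\<in>A. b k a * pmf (trans_pmf h a) z)" for k z
  proof (cases "z \<in> A")
    case True
    let ?E = "\<lambda>a. {\<omega> \<in> space (M x). st k \<omega> \<and> X (real k * h) \<omega> = a \<and> X (real (Suc k) * h) \<omega> = z}"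
    have m: "?E a \<in> sets (M x)" for a
      by (intro sets.sets_Collect_conj st_sets X_sets)
    have "{\<omega> \<in> space (M x). st (Suc k) \<omega> \<and> X (real (Suc k) * h) \<omega> = z} = (\<Union>a\<in>A. ?E a)"
      using True st_A[of k] unfolding st_Suc by blast
    then have "b (Suc k) z = (\<Sum>a\<in>A. measure (M x) (?E a))"
      unfolding b_def using m assms
        by (subst finite_measure_finite_Union[symmetric]) (auto simp: disjoint_family_on_def)
    also have "\<dots> = (\<Sum>a\<in>A. b k a * pmf (trans_pmf h a) z)"
      unfolding b_def st_def by (intro sum.cong refl markov_property_set[OF assms])
    finally show ?thesis using True by simp
  next
    case False
    then have "{\<omega> \<in> space (M x). st (Suc k) \<omega> \<and> X (real (Suc k) * h) \<omega> = z} = {}"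
      using st_A[of "Suc k"] by blast
    then show ?thesis using False by (simp only: b_def) simp
  qed
  have Tf: "T f a = indicator A a * (\<Sum>z\<in>A. pmf (trans_pmf h a) z * f z)"
    if "\<And>z. z \<notin> A \<Longrightarrow> f z = 0" for f a
    unfolding T_def using that assms
    by (subst integral_measure_pmf_real[of A]) (auto simp: mult.commute)
  have b_0: "b 0 a = indicator A a * indicator {x} a" for a
  proof (cases "a \<in> A")
    case True
    then have "{\<omega> \<in> space (M x). st 0 \<omega> \<and> X (real 0 * h) \<omega> = a} = {\<omega> \<in> space (M x). X 0 \<omega> = a}"
      by (auto simp: st_def)
    then have "b 0 a = pmf (trans_pmf 0 x) a"
      by (simp only: b_def pmf_trans_pmf[OF order_refl])
    then show ?thesis using True by (simp add: trans_pmf_0 indicator_def)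
  next
    case False
    then have "{\<omega> \<in> space (M x). st 0 \<omega> \<and> X (real 0 * h) \<omega> = a} = {}" using st_A[of 0] by blast
    then show ?thesis using False by (simp only: b_def) simp
  qed
  \<comment> \<open>The duality: one step is moved from the law \<open>b\<close> to the test
    function, so the induction must allow every \<open>f\<close> vanishing off
    \<open>A\<close>.\<close>
  have sum_T: "(\<Sum>z\<in>A. b k z * f z) = indicator A x * (T ^^ k) f x" if "\<And>z. z \<notin> A \<Longrightarrow> f z = 0" for k f
    using that
  proof (induction k arbitrary: f)
    case 0
    have "(\<Sum>z\<in>A. b 0 z * f z) = (\<Sum>z\<in>A. if z = x then f x else 0)"
      by (intro sum.cong refl) (auto simp: b_0 indicator_def)
    then show ?case using assms by (simp add: indicator_def)
  next
    case (Suc k)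
    have "(\<Sum>z\<in>A. b (Suc k) z * f z) = (\<Sum>z\<in>A. \<Sum>a\<in>A. b k a * (pmf (trans_pmf h a) z * f z))"
      unfolding b_Suc by (intro sum.cong refl) (simp add: sum_distrib_right mult.assoc)
    also have "\<dots> = (\<Sum>a\<in>A. b k a * T f a)"
      by (subst sum.swap, intro sum.cong refl) (simp add: Tf[OF Suc.prems] sum_distrib_left)
    also have "\<dots> = indicator A x * (T ^^ k) (T f) x"
      by (rule Suc.IH) (simp add: T_def)
    finally show ?case by (simp add: funpow_swap1)
  qed
  have "measure (M x) {\<omega> \<in> space (M x). st k \<omega>} = (\<Sum>z\<in>A. b k z * indicator A z)"
  proof -
    let ?E = "\<lambda>a. {\<omega> \<in> space (M x). st k \<omega> \<and> X (real k * h) \<omega> = a}"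
    have m: "?E a \<in> sets (M x)" for a
      by (intro sets.sets_Collect_conj st_sets X_sets)
    have "{\<omega> \<in> space (M x). st k \<omega>} = (\<Union>a\<in>A. ?E a)" using st_A[of k] by blast
    then have "measure (M x) {\<omega> \<in> space (M x). st k \<omega>} = (\<Sum>a\<in>A. b k a)"
      unfolding b_def using m assms
        by (subst finite_measure_finite_Union[symmetric]) (auto simp: disjoint_family_on_def)
    then show ?thesis by simp
  qed
  also have "\<dots> = indicator A x * stay h A k x"
    unfolding stayT by (intro sum_T) simp
  also have "\<dots> = stay h A k x" by (cases "x \<in> A") (simp_all add: stay_outside)
  finally show ?thesis by (simp add: st_def)
qed

text \<open>The finite set does not depend on the mesh of the time grid, since all grid points are rational
  multiples of \<open>t\<close>.\<close>
lemma exists_finite_stay: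
  assumes "nonexplosive M X" "0 \<le> t" "0 < \<epsilon>"
  shows "\<exists>A. finite A \<and> (\<forall>B m. finite B \<longrightarrow> A \<subseteq> B \<longrightarrow> 1 - stay (t / real m) B m x < \<epsilon>)"
proof -
  interpret prob_space "M x" by simp
  define Q where "Q = \<rat> \<inter> {0..1::real}"
  have Q: "countable Q" "Q \<noteq> {}"
    by (auto simp: Q_def countable_rat intro!: countable_Int1 exI[of _ 0])
  have m [measurable]: "q \<in> Q \<Longrightarrow> X (t * q) \<in> M x \<rightarrow>\<^sub>M count_space UNIV" for q
    using assms by (intro measurable_X) (auto simp: Q_def)
  \<comment> \<open>An exhaustion of the countable state space by finite sets; a path with finite
    range lies in one of them.\<close>
  define A where "A n = {z :: 'a. to_nat z \<le> n}" for n
  have A: "finite (A n)" for n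
    unfolding A_def by (rule finite_to_nat_le)
  define C where "C n = {\<omega> \<in> space (M x). \<forall>q\<in>Q. X (t * q) \<omega> \<in> A n}" for n
  have C_sets: "C n \<in> sets (M x)" for n
  proof -
    have "C n = (\<Inter>q\<in>Q. {\<omega> \<in> space (M x). X (t * q) \<omega> \<in> A n})" using Q(2) by (auto simp: C_def)
    also have "\<dots> \<in> sets (M x)"
      using Q assms by (intro sets.countable_INT' image_subsetI sets_X) (auto simp: Q_def)
    finally show ?thesis .
  qed
  have "(\<lambda>n. measure (M x) (C n)) \<longlonglongrightarrow> measure (M x) (\<Union>n. C n)"
    using C_sets
      by (intro finite_Lim_measure_incseq) (auto simp: incseq_def C_def A_def intro: order_trans)
  moreover have "measure (M x) (\<Union>n. C n) = 1"
  proof (rule prob_eq_1[THEN iffD2])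
    have "AE \<omega> in M x. nonexplosive_path (\<lambda>t. X t \<omega>)"
      using assms by (simp add: nonexplosive_def)
    then show "AE \<omega> in M x. \<omega> \<in> (\<Union>n. C n)"
    proof (rule AE_mp, intro AE_I2 impI)
      fix \<omega> assume \<omega>: "\<omega> \<in> space (M x)" "nonexplosive_path (\<lambda>t. X t \<omega>)"
      have "finite ((\<lambda>t. X t \<omega>) ` {0..t})" by (rule nonexplosive_path_finite_range) fact
      then have "finite (to_nat ` (\<lambda>t. X t \<omega>) ` {0..t})" by simp
      then obtain n where "\<forall>k\<in>to_nat ` (\<lambda>t. X t \<omega>) ` {0..t}. k \<le> n"
        using finite_nat_set_iff_bounded_le by blast
      moreover have "t * q \<in> {0..t}" if "q \<in> Q" for q
        using that assms by (auto simp: Q_def mult_left_le)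
      ultimately show "\<omega> \<in> (\<Union>n. C n)" using \<omega> by (auto simp: C_def A_def intro!: exI[of _ n])
    qed
  qed (use C_sets in auto)
  ultimately have "\<forall>\<^sub>F n in sequentially. 1 - \<epsilon> < measure (M x) (C n)"
    using assms by (intro order_tendstoD) auto
  then obtain n where n: "1 - \<epsilon> < measure (M x) (C n)" by (auto simp: eventually_sequentially)
  show ?thesis
  proof (intro exI[of _ "A n"] conjI allI impI)
    fix B m assume B: "finite B" "A n \<subseteq> B"
    have [measurable]: "X (real j * (t / real m)) \<in> M x \<rightarrow>\<^sub>M count_space UNIV" for j
      using assms by simp
    have "C n \<subseteq> {\<omega> \<in> space (M x). \<forall>j\<le>m. X (real j * (t / m)) \<omega> \<in> B}"
    proof (auto simp: C_def)
      fix \<omega> j assume *: "\<forall>q\<in>Q. X (t * q) \<omega> \<in> A n" "j \<le> m"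
      \<comment> \<open>This includes \<open>m = 0\<close>, where the quotient 0 / 0 is 0.\<close>
      have "real j / real m \<in> Q" using *(2) by (auto simp: Q_def divide_le_eq_1)
      then have "X (t * (real j / real m)) \<omega> \<in> A n" using * by blast
      then show "X (real j * t / real m) \<omega> \<in> B" using B by (auto simp: mult.commute)
    qed
    then have "measure (M x) (C n) \<le> stay (t / real m) B m x"
      using assms B by (subst stay_eq) (auto intro!: finite_measure_mono)
    with n show "1 - stay (t / real m) B m x < \<epsilon>" by simp
  qed (rule A)
qed

end

section \<open>From one-step couplings to a curvature bound\<close>

text \<open>Couple over the first step and continue from the resulting pair by induction. One-step
  errors add up, each multiplied by a discount factor of at most \<open>B\<close>. Outside
  \<open>A\<close> nothing is known, but there a \<open>stay\<close> term vanishes and the bound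
  exceeds the trivial bound 1 on the cost.\<close>

lemma (in countable_markov) iterate_coupling:
  assumes d: "\<And>x y. 0 \<le> d x y" "\<And>x y. d x y \<le> 1"
    and h: "0 \<le> h" "0 \<le> \<epsilon>"
    and step: "\<And>x y. x \<in> A \<Longrightarrow> y \<in> A \<Longrightarrow>
       \<exists>\<pi>. is_coupling \<pi> (trans_pmf h x) (trans_pmf h y) \<and> cost d \<pi> \<le> exp (- r * h) * d x y + \<epsilon> * h"
    and B: "\<And>k. k \<le> m \<Longrightarrow> exp (- r * (real k * h)) \<le> B"
  shows "k \<le> m \<Longrightarrow> \<exists>\<pi>. is_coupling \<pi> (trans_pmf (k * h) x) (trans_pmf (k * h) y) \<and>
     cost d \<pi> \<le>
       exp (- r * (k * h)) * d x y + k * h * \<epsilon> * B + (1 - stay h A k x) + (1 - stay h A k y)"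
proof (induction k arbitrary: x y)
  case 0
  show ?case
    by (intro exI[of _ "return_pmf (x, y)"])
      (use stay_bounds(2)[of h A 0] in \<open>auto simp: is_coupling_def trans_pmf_0 indicator_def\<close>)
next
  case (Suc k)
  have B0: "0 \<le> B" using B[of 0] by simp
  show ?case
  proof (cases "x \<in> A \<and> y \<in> A")
    case True
    \<comment> \<open>A choice of continuation for every pair, to be used as a kernel.\<close>
    define C where "C u v = (SOME \<rho>. is_coupling \<rho> (trans_pmf (k * h) u) (trans_pmf (k * h) v) \<and>
      cost d \<rho> \<le>
        exp (- r * (k * h)) * d u v + k * h * \<epsilon> * B + (1 - stay h A k u) +
          (1 - stay h A k v))" for u v
    have "is_coupling (C u v) (trans_pmf (k * h) u) (trans_pmf (k * h) v) \<and>
      cost d (C u v) \<le>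
        exp (- r * (k * h)) * d u v + k * h * \<epsilon> * B + (1 - stay h A k u) +
          (1 - stay h A k v)" for u v
      unfolding C_def by (rule someI_ex, rule Suc.IH) (use Suc.prems in simp)
    then have C: "\<And>u v. is_coupling (C u v) (trans_pmf (k * h) u) (trans_pmf (k * h) v)"
      "\<And>u v. cost d (C u v) \<le>
        exp (- r * (k * h)) * d u v + k * h * \<epsilon> * B + (1 - stay h A k u) + (1 - stay h A k v)"
      by blast+
    obtain \<pi> where \<pi>: "is_coupling \<pi> (trans_pmf h x)
      (trans_pmf h y)" "cost d \<pi> \<le> exp (- r * h) * d x y + \<epsilon> * h"
      using step True by blast
    define \<pi>' where "\<pi>' = bind_pmf \<pi> (\<lambda>z. C (fst z) (snd z))"
    have eq: "real (Suc k) * h = h + k * h" by (simp add: algebra_simps)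
    have "is_coupling \<pi>' (trans_pmf (Suc k * h) x) (trans_pmf (Suc k * h) y)"
    proof -
      have e: "trans_pmf h x = map_pmf fst \<pi>" "trans_pmf h y = map_pmf snd \<pi>"
        using \<pi>(1) by (auto simp: is_coupling_def)
      have "trans_pmf (h + k * h) x = bind_pmf (map_pmf fst \<pi>) (trans_pmf (k * h))"
        "trans_pmf (h + k * h) y = bind_pmf (map_pmf snd \<pi>) (trans_pmf (k * h))"
        unfolding e[symmetric] using h by (auto intro: trans_pmf_add)
      then show ?thesis
        using C(1) unfolding is_coupling_def eq \<pi>'_def by (simp add: map_bind_pmf bind_map_pmf)
    qed
    moreover have "cost d \<pi>' \<le>
      exp (- r * (Suc k * h)) * d x y + Suc k * h * \<epsilon> * B + (1 - stay h A (Suc k) x) +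
        (1 - stay h A (Suc k) y)"
    proof -
      have int_s: "integrable (measure_pmf \<pi>) (\<lambda>z. stay h A k (f z))" for f :: "'a \<times> 'a \<Rightarrow> 'a"
        using stay_bounds
          by (intro integrable_pmf_bounded[of _ 1]) (auto simp: abs_le_iff order_trans[of _ 0])
      have id: "integrable (measure_pmf \<pi>) (\<lambda>z. d (fst z) (snd z))"
        using d by (intro integrable_pmf_bounded[of _ 1]) auto
      \<comment> \<open>Averaging the escape terms over the first step reproduces the recursion of
        \<open>stay\<close>, since both starting points lie in \<open>A\<close>.\<close>
      have Es: "measure_pmf.expectation \<pi> (\<lambda>z. stay h A k (fst z)) = stay h A (Suc k) x"
        "measure_pmf.expectation \<pi> (\<lambda>z. stay h A k (snd z)) = stay h A (Suc k) y"
        using \<pi>(1) True by (auto simp: is_coupling_def simp flip: integral_map_pmf)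
      have "cost d \<pi>' = measure_pmf.expectation \<pi> (\<lambda>z. cost d (C (fst z) (snd z)))"
        unfolding \<pi>'_def using d by (intro expectation_bind_pmf[of _ 1]) auto
      also have "\<dots> \<le> measure_pmf.expectation \<pi> (\<lambda>z. exp (- r * (k * h)) * d (fst z)
        (snd z) + k * h * \<epsilon> * B
          + (1 - stay h A k (fst z)) + (1 - stay h A k (snd z)))"
      proof (rule integral_mono)
        have "0 \<le> cost d \<rho>" "cost d \<rho> \<le> 1" for \<rho>
          using d by (auto intro!: integral_nonneg_AE measure_pmf.integral_le_const integrable_pmf_bounded[of _ 1])
        then show "integrable (measure_pmf \<pi>) (\<lambda>z. cost d (C (fst z) (snd z)))"
          by (intro integrable_pmf_bounded[of _ 1]) auto
      qed (use int_s id C(2) in auto)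
      also have "\<dots> = exp (- r * (k * h)) * cost d \<pi> + k * h * \<epsilon> * B
          + (1 - stay h A (Suc k) x) + (1 - stay h A (Suc k) y)"
        using int_s id Es by (simp add: measure_pmf.prob_space del: stay.simps)
      also have "exp (- r * (k * h)) * cost d \<pi> \<le>
        exp (- r * (k * h)) * (exp (- r * h) * d x y + \<epsilon> * h)"
        using \<pi>(2) by (intro mult_left_mono) auto
      also have "\<dots> = exp (- r * (Suc k * h)) * d x y + exp (- r * (k * h)) * (\<epsilon> * h)"
        by (simp add: algebra_simps flip: exp_add)
      also have "exp (- r * (k * h)) * (\<epsilon> * h) \<le> B * (\<epsilon> * h)"
        using B[of k] Suc.prems h by (intro mult_right_mono) auto
      finally show ?thesis by (simp add: algebra_simps del: stay.simps)
    qed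
    ultimately show ?thesis by blast
  next
    case False
    have "0 \<le> exp (- r * (Suc k * h)) * d x y + Suc k * h * \<epsilon> * B"
      using d h B0 by simp
    moreover have "cost d \<rho> \<le> 1" for \<rho>
      using d by (auto intro!: measure_pmf.integral_le_const integrable_pmf_bounded[of _ 1])
    moreover have "1 \<le> (1 - stay h A (Suc k) x) + (1 - stay h A (Suc k) y)"
      using False stay_bounds(2)[of h A "Suc k" x] stay_bounds(2)[of h A "Suc k" y]
        stay_outside[of x A h "Suc k"] stay_outside[of y A h "Suc k"] by linarith
    ultimately have "cost d \<rho> \<le>
      exp (- r * (Suc k * h)) * d x y + Suc k * h * \<epsilon> * B + (1 - stay h A (Suc k) x) +
        (1 - stay h A (Suc k) y)" for \<rho>
      by (smt (verit))
    \<comment> \<open>Any coupling will do here; the independent one is taken.\<close>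
    then show ?thesis
      by (intro exI[of _ "pair_pmf (trans_pmf (Suc k * h) x) (trans_pmf (Suc k * h) y)"] conjI)
         (auto simp: is_coupling_def map_fst_pair_pmf map_snd_pair_pmf)
  qed
qed

text \<open>The local estimate need not be uniform in the pair of states. Confinement to a finite
  set makes it uniform, and the loss \<open>\<eta>\<close> splits into three thirds: the accumulated
  one-step errors and the two escape probabilities.\<close>

lemma (in countable_markov) coarse_ricci_ge_of_local_coupling:
  assumes d: "\<And>x y. 0 \<le> d x y" "\<And>x y. d x y \<le> 1"
    and nonexpl: "nonexplosive M X"
    and loc: "\<And>x y \<epsilon>. 0 < \<epsilon> \<Longrightarrow> \<forall>\<^sub>F h in at_right 0.
       \<exists>\<pi>. is_coupling \<pi> (trans_pmf h x) (trans_pmf h y) \<and> cost d \<pi> \<le> exp (- r * h) * d x y + \<epsilon> * h"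
  shows "ereal r \<le> coarse_ricci d (transition_law M X)"
  unfolding coarse_ricci_def
proof (rule Sup_upper, intro CollectI exI[of _ r] conjI allI impI refl)
  fix t :: real and x y :: 'a
  assume t: "0 \<le> t"
  show "wasserstein d (transition_law M X t x)
    (transition_law M X t y) \<le> ennreal (exp (- r * t) * d x y)"
  proof (cases "t = 0")
    case True
    have "is_coupling (return_pmf (x, y)) (trans_pmf 0 x) (trans_pmf 0 y)"
      by (simp add: is_coupling_def trans_pmf_0)
    from wasserstein_le_cost[where d = d, OF this d] True show ?thesis
      by (simp add: transition_law_eq)
  next
    case False
    with t have t: "0 < t" by simp
    show ?thesis
    proof (rule ennreal_le_epsilon)
      fix \<eta> :: real assume \<eta>: "0 < \<eta>"
      define B where "B = exp (\<bar>r\<bar> * t)"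
      have B: "0 < B" by (simp add: B_def)
      \<comment> \<open>Chosen so that the accumulated error \<open>t * \<epsilon> * B\<close> is
        \<open>\<eta> / 3\<close>.\<close>
      define \<epsilon> where "\<epsilon> = \<eta> / (3 * t * B)"
      have \<epsilon>: "0 < \<epsilon>" using \<eta> t B by (simp add: \<epsilon>_def)
      obtain A1 where
        A1: "finite A1" "\<And>A m. finite A \<Longrightarrow> A1 \<subseteq> A \<Longrightarrow> 1 - stay (t / real m) A m x < \<eta> / 3"
        using exists_finite_stay[OF nonexpl, of t "\<eta> / 3" x] t \<eta> by auto
      obtain A2 where
        A2: "finite A2" "\<And>A m. finite A \<Longrightarrow> A2 \<subseteq> A \<Longrightarrow> 1 - stay (t / real m) A m y < \<eta> / 3"
        using exists_finite_stay[OF nonexpl, of t "\<eta> / 3" y] t \<eta> by auto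
      \<comment> \<open>The escape bounds hold for all finite supersets and all meshes, so
        \<open>A\<close> can be fixed before \<open>m\<close>.\<close>
      define A where "A = A1 \<union> A2"
      have A: "finite A" using A1 A2 by (simp add: A_def)
      have "\<forall>\<^sub>F h in at_right 0. \<forall>z\<in>A \<times> A.
         \<exists>\<pi>. is_coupling \<pi> (trans_pmf h (fst z))
           (trans_pmf h (snd z)) \<and> cost d \<pi> \<le> exp (- r * h) * d (fst z) (snd z) + \<epsilon> * h"
        using A loc[OF \<epsilon>] by (intro eventually_ball_finite) auto
      moreover have "filterlim (\<lambda>m. t / real m) (at_right 0) sequentially"
        using t by real_asymp
      ultimately have "\<forall>\<^sub>F m in sequentially. \<forall>z\<in>A \<times> A.
         \<exists>\<pi>. is_coupling \<pi> (trans_pmf (t / m) (fst z)) (trans_pmf (t / m) (snd z)) \<and>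
           cost d \<pi> \<le> exp (- r * (t / m)) * d (fst z) (snd z) + \<epsilon> * (t / m)"
        by (rule eventually_compose_filterlim)
      from eventually_happens'[OF _ eventually_conj[OF this eventually_gt_at_top[of 0]]]
      obtain m :: nat where "0 < m" and loc_m: "\<forall>z\<in>A \<times> A.
         \<exists>\<pi>. is_coupling \<pi> (trans_pmf (t / m) (fst z)) (trans_pmf (t / m) (snd z)) \<and>
           cost d \<pi> \<le> exp (- r * (t / m)) * d (fst z) (snd z) + \<epsilon> * (t / m)"
        by auto
      have m: "0 < m" "\<And>x y. x \<in> A \<Longrightarrow> y \<in> A \<Longrightarrow>
         \<exists>\<pi>. is_coupling \<pi> (trans_pmf (t / m) x) (trans_pmf (t / m) y) \<and>
           cost d \<pi> \<le> exp (- r * (t / m)) * d x y + \<epsilon> * (t / m)"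
        using \<open>0 < m\<close> bspec[OF loc_m, of "(u, v)" for u v] by auto
      have exp_le: "exp (- r * (real k * (t / real m))) \<le> B" if "k \<le> m" for k
      proof -
        have "- r * (real k * (t / real m)) \<le> \<bar>r\<bar> * (real k * (t / real m))"
          using t by (intro mult_right_mono) auto
        also have "\<dots> \<le> \<bar>r\<bar> * t"
          using t m that by (intro mult_left_mono) (auto simp: field_simps)
        finally show ?thesis by (simp add: B_def)
      qed
      have "\<exists>\<pi>. is_coupling \<pi> (trans_pmf (m * (t / m)) x) (trans_pmf (m * (t / m)) y) \<and>
         cost d \<pi> \<le>
           exp (- r * (m * (t / m))) * d x y + m * (t / m) * \<epsilon> * B + (1 - stay (t / m) A m x) +
             (1 - stay (t / m) A m y)"
        using t \<epsilon> by (intro iterate_coupling[where m = m and B = B] d m(2) exp_le) simp_all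
      then obtain \<pi> where \<pi>: "is_coupling \<pi> (trans_pmf t x) (trans_pmf t y)"
         "cost d \<pi> \<le>
           exp (- r * t) * d x y + t * \<epsilon> * B + (1 - stay (t / m) A m x) + (1 - stay (t / m) A m y)"
        using m by auto
      have "t * \<epsilon> * B = \<eta> / 3" using t B by (simp add: \<epsilon>_def)
      with \<pi>(2) A1(2)[of A m] A2(2)[of A m] A have "cost d \<pi> \<le> exp (- r * t) * d x y + \<eta>"
        by (auto simp: A_def)
      then have "ennreal (cost d \<pi>) \<le> ennreal (exp (- r * t) * d x y) + ennreal \<eta>"
        using d \<eta> by (simp add: ennreal_leI flip: ennreal_plus)
      then show "wasserstein d (transition_law M X t x)
        (transition_law M X t y) \<le> ennreal (exp (- r * t) * d x y) + ennreal \<eta>"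
        using order_trans[OF wasserstein_le_cost[where d = d, OF \<pi>(1) d]] t
          by (simp add: transition_law_eq)
    qed
  qed
qed

section \<open>Coupling of Euler steps\<close>

lemma config_dist_nonneg [simp]: "0 \<le> config_dist xs ys"
  by (simp add: config_dist_def sum_nonneg)

lemma config_dist_le_1 [simp]: "config_dist xs ys \<le> 1"
proof -
  have "(\<Sum>i\<in>UNIV. trivial_dist (xs i) (ys i)) \<le> (\<Sum>i\<in>(UNIV :: 'a set). 1)"
    by (intro sum_mono) simp
  then show ?thesis by (simp add: config_dist_def)
qed

lemma config_dist_self [simp]: "config_dist xs xs = 0"
  by (simp add: config_dist_def)

lemma config_dist_triangle: "config_dist xs zs \<le> config_dist xs ys + config_dist ys zs"
  unfolding config_dist_def add_divide_distrib[symmetric] sum.distrib[symmetric]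
  by (intro divide_right_mono sum_mono) (auto simp: trivial_dist_def)

lemma config_dist_commute: "config_dist xs ys = config_dist ys xs"
  by (simp add: config_dist_def trivial_dist_def eq_commute)

lemma config_dist_le_trivial_dist: "config_dist xs ys \<le> trivial_dist xs ys"
  by (auto simp: trivial_dist_def)

text \<open>The stability under replacement of both arguments that \<open>glue_coupling\<close> asks
  of \<open>d\<close>.\<close>

lemma config_dist_perturb:
  "config_dist xs' ys' \<le> config_dist xs ys + trivial_dist xs xs' + trivial_dist ys ys'"
  using config_dist_triangle[of xs' ys' xs] config_dist_triangle[of xs ys' ys]
    config_dist_le_trivial_dist[of xs xs'] config_dist_le_trivial_dist[of ys ys']
    config_dist_commute[of xs xs'] by linarith

lemma config_dist_upd:
  fixes xs ys :: "'n::finite \<Rightarrow> 'e"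
  shows "config_dist (xs(i := u)) (ys(i := v)) =
    config_dist xs ys - trivial_dist (xs i) (ys i) / CARD('n) + trivial_dist u v / CARD('n)"
proof -
  have "(\<Sum>j\<in>UNIV. trivial_dist ((xs(i := u)) j) ((ys(i := v)) j)) =
    trivial_dist u v + (\<Sum>j\<in>UNIV - {i}. trivial_dist (xs j) (ys j))"
    by (subst sum.remove[of _ i]) auto
  also have "(\<Sum>j\<in>UNIV - {i}. trivial_dist (xs j) (ys j)) =
    (\<Sum>j\<in>UNIV. trivial_dist (xs j) (ys j)) - trivial_dist (xs i) (ys i)"
    by (subst (2) sum.remove[of _ i]) auto
  finally show ?thesis by (simp add: config_dist_def add_divide_distrib diff_divide_distrib)
qed

section \<open>Lazy jumps of one coordinate\<close>

definition lazy_pmf :: "real \<Rightarrow> 'a \<Rightarrow> 'a pmf \<Rightarrow> 'a pmf" where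
  "lazy_pmf a x p = bind_pmf (bernoulli_pmf a) (\<lambda>b. if b then p else return_pmf x)"

lemma expectation_lazy_pmf:
  fixes f :: "'a \<Rightarrow> real"
  assumes "0 \<le> a" "a \<le> 1" "\<And>z. 0 \<le> f z" "\<And>z. f z \<le> B"
  shows "measure_pmf.expectation (lazy_pmf a x p) f = f x + a * (measure_pmf.expectation p f - f x)"
  unfolding lazy_pmf_def using assms
    by (subst expectation_bind_pmf[of _ B]) (auto simp: algebra_simps)

lemma pmf_lazy_pmf:
  assumes "0 \<le> a" "a \<le> 1"
  shows "pmf (lazy_pmf a x p) z = a * pmf p z + (1 - a) * indicator {z} x"
  unfolding lazy_pmf_def using assms by (auto simp: pmf_bind)

text \<open>The two laws differ by (a - b) times the difference of \<open>p\<close> and the point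
  mass at \<open>x\<close>. This is the origin of the factor 1 - P_xx in front of the Lipschitz
  norm.\<close>

lemma tv_norm_lazy_same_base:
  assumes "0 \<le> a" "a \<le> 1" "0 \<le> b" "b \<le> 1"
  shows "tv_norm (lazy_pmf a x p) (lazy_pmf b x p) / 2 = \<bar>a - b\<bar> * (1 - pmf p x)"
proof -
  have "\<bar>pmf (lazy_pmf a x p) z - pmf (lazy_pmf b x p) z\<bar> =
      \<bar>a - b\<bar> * (pmf p z + (1 - 2 * pmf p x) * indicator {x} z)" for z
  proof -
    have "pmf (lazy_pmf a x p) z - pmf (lazy_pmf b x p) z = (a - b) * (pmf p z - indicator {z} x)"
      using assms by (simp add: pmf_lazy_pmf algebra_simps)
    \<comment> \<open>At \<open>z = x\<close> both sides are 1 - p x; elsewhere they are p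
      z.\<close>
    moreover have "\<bar>pmf p z - indicator {z} x\<bar> = pmf p z + (1 - 2 * pmf p x) * indicator {x} z"
      by (auto simp: indicator_def pmf_le_1)
    ultimately show ?thesis by (simp add: abs_mult)
  qed
  then show ?thesis by (simp add: tv_norm_eq_integral)
qed

text \<open>The overlap of the lazy kernels is at least \<open>min a b\<close> times that of \<open>p\<close> and \<open>q\<close>.\<close>
lemma tv_norm_lazy_le:
  assumes "0 \<le> a" "a \<le> 1" "0 \<le> b" "b \<le> 1"
  shows "tv_norm (lazy_pmf a x p) (lazy_pmf b y q) / 2 \<le> 1 - min a b * (1 - tv_norm p q / 2)"
proof -
  define m where "m = min a b"
  \<comment> \<open>From |u - v| = u + v - 2 min (u, v): the lazy laws dominate a p and b q, so
    their minimum is at least m min (p, q).\<close>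
  let ?g = "\<lambda>z. pmf (lazy_pmf a x p) z + pmf (lazy_pmf b y q) z - m * (pmf p z +
    pmf q z - \<bar>pmf p z - pmf q z\<bar>)"
  have "tv_norm (lazy_pmf a x p) (lazy_pmf b y q) \<le> (\<integral>z. ?g z \<partial>count_space UNIV)"
    unfolding tv_norm_eq_integral
  proof (rule integral_mono)
    fix z
    have m: "0 \<le> m" "m \<le> a" "m \<le> b" using assms by (auto simp: m_def)
    have "m * min (pmf p z) (pmf q z) \<le> a * pmf p z" "m * min (pmf p z) (pmf q z) \<le> b * pmf q z"
      using m assms by (auto intro!: mult_mono)
    moreover have "a * pmf p z \<le> pmf (lazy_pmf a x p) z" "b * pmf q z \<le> pmf (lazy_pmf b y q) z"
      using assms by (auto simp: pmf_lazy_pmf)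
    moreover have "pmf p z + pmf q z - \<bar>pmf p z - pmf q z\<bar> = 2 * min (pmf p z) (pmf q z)" by simp
    ultimately show "\<bar>pmf (lazy_pmf a x p) z - pmf (lazy_pmf b y q) z\<bar> \<le> ?g z"
      by (simp only: mult.left_commute[of m 2])
  qed auto
  also have "\<dots> = 2 - m * (2 - tv_norm p q)"
    by (simp add: tv_norm_eq_integral)
  finally show ?thesis by (simp add: m_def field_simps)
qed

text \<open>The factor \<open>N\<close> compensates for the uniform choice of the jumping coordinate.  The value is a
  probability only for small \<open>h\<close>.\<close>
definition jump_prob :: "('e \<Rightarrow> ('n::finite \<Rightarrow> 'e) \<Rightarrow> real) \<Rightarrow> real \<Rightarrow> ('n \<Rightarrow> 'e) \<Rightarrow> 'n \<Rightarrow> real" where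
  "jump_prob c h xs i = real CARD('n) * h * c (xs i) xs"

definition coord_pmf where
  "coord_pmf P c h xs i = lazy_pmf (jump_prob c h xs i) (xs i) (P (xs i))"

definition euler_pmf ::
  "('e \<Rightarrow> 'e pmf) \<Rightarrow> ('e \<Rightarrow> ('n::finite \<Rightarrow> 'e) \<Rightarrow> real) \<Rightarrow> real \<Rightarrow> ('n \<Rightarrow> 'e) \<Rightarrow> ('n \<Rightarrow> 'e) pmf" where
  "euler_pmf P c h xs =
     bind_pmf (pmf_of_set UNIV) (\<lambda>i. map_pmf (\<lambda>u. xs(i := u)) (coord_pmf P c h xs i))"

text \<open>The Euler step is exactly the identity plus h times the generator, because the factor N
  in \<open>jump_prob\<close> cancels the uniform weight 1/N. In particular its probabilities are
  affine in \<open>h\<close>.\<close>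

lemma expectation_euler_pmf:
  fixes f :: "('n::finite \<Rightarrow> 'e) \<Rightarrow> real"
  assumes adm: "\<And>i. 0 \<le> jump_prob c h xs i" "\<And>i. jump_prob c h xs i \<le> 1"
    and f: "\<And>z. 0 \<le> f z" "\<And>z. f z \<le> 1"
  shows "measure_pmf.expectation (euler_pmf P c h xs) f = f xs + h * particle_generator P c f xs"
proof -
  let ?N = "real CARD('n)"
  have gen: "(\<Sum>\<^sub>\<infinity>y. pmf (P (xs i)) y * (f (xs(i := y)) - f xs)) =
      measure_pmf.expectation (P (xs i)) (\<lambda>y. f (xs(i := y))) - f xs" for i
  proof -
    have "\<bar>f z - f xs\<bar> \<le> 1" for z using f(1)[of z] f(1)[of xs] f(2)[of z] f(2)[of xs] by auto
    moreover have "integrable (measure_pmf (P (xs i))) (\<lambda>y. f (xs(i := y)))"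
      using f by (intro integrable_pmf_bounded[of _ 1]) simp
    ultimately show ?thesis
      by (subst infsum_pmf_eq_expectation[of _ 1]) (auto simp: measure_pmf.prob_space)
  qed
  have "measure_pmf.expectation (euler_pmf P c h xs) f =
    (\<Sum>i\<in>UNIV. measure_pmf.expectation (coord_pmf P c h xs i) (\<lambda>u. f (xs(i := u)))) / ?N"
    unfolding euler_pmf_def using f
      by (subst expectation_bind_pmf[of _ 1]) (auto simp: integral_pmf_of_set)
  also have "\<dots> = (\<Sum>i\<in>UNIV. f xs + jump_prob c h xs i * (measure_pmf.expectation (P (xs i))
    (\<lambda>y. f (xs(i := y))) - f xs)) / ?N"
    unfolding coord_pmf_def using f adm by (subst expectation_lazy_pmf[of _ _ 1]) auto
  also have "\<dots> = f xs + h * particle_generator P c f xs"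
    by (simp add: particle_generator_def gen jump_prob_def sum.distrib add_divide_distrib sum_divide_distrib
        sum_distrib_left mult_ac)
  finally show ?thesis .
qed

lemma eventually_jump_prob_le_1:
  fixes xs :: "'n::finite \<Rightarrow> 'e"
  assumes "\<And>x xs. 0 \<le> c x xs"
  shows "\<forall>\<^sub>F h in at_right 0. \<forall>i. 0 \<le> jump_prob c h xs i \<and> jump_prob c h xs i \<le> 1"
proof -
  have "\<forall>\<^sub>F h in at_right 0. jump_prob c h xs i < 1" for i
  proof (rule order_tendstoD)
    have "((\<lambda>h. jump_prob c h xs i) \<longlongrightarrow> real CARD('n) * 0 * c (xs i) xs) (at_right 0)"
      unfolding jump_prob_def by (intro tendsto_intros)
    then show "((\<lambda>h. jump_prob c h xs i) \<longlongrightarrow> 0) (at_right 0)" by simp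
  qed simp
  then have "\<forall>\<^sub>F h in at_right 0. \<forall>i\<in>UNIV. jump_prob c h xs i < 1"
    by (intro eventually_ball_finite) auto
  then show ?thesis
    using eventually_at_right_less[of 0]
  proof eventually_elim
    case (elim h)
    have "0 \<le> jump_prob c h xs i" for i
      unfolding jump_prob_def using assms elim(2) by (intro mult_nonneg_nonneg) auto
    with elim show ?case by (auto intro: less_imp_le)
  qed
qed

text \<open>Both systems select the same coordinate and couple its new values maximally. Agreeing
  coordinates create discrepancy at rate at most S d by \<open>lip\<close>; disagreeing ones remove
  it at rate at least (r + S) d by \<open>curv\<close>. The net drift is at most -r d.\<close>

lemma euler_coupling:
  fixes xs ys :: "'n::finite \<Rightarrow> 'e"
  assumes adm: "\<And>i. 0 \<le> jump_prob c h xs i" "\<And>i. jump_prob c h xs i \<le> 1"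
      "\<And>i. 0 \<le> jump_prob c h ys i" "\<And>i. jump_prob c h ys i \<le> 1"
    and h: "0 \<le> h" and S: "0 \<le> S"
    and lip: "\<And>i. xs i = ys i \<Longrightarrow>
      (1 - pmf (P (xs i)) (xs i)) * \<bar>c (xs i) xs - c (xs i) ys\<bar> \<le> S * config_dist xs ys"
    and curv: "\<And>i. xs i \<noteq> ys i \<Longrightarrow> r + S \<le> theta P (xs i) (ys i) * min (c (xs i) xs) (c (ys i) ys)"
  shows "\<exists>\<pi>. is_coupling \<pi> (euler_pmf P c h xs) (euler_pmf P c h ys) \<and>
    cost config_dist \<pi> \<le> (1 - r * h) * config_dist xs ys"
proof -
  let ?N = "real CARD('n)" and ?d = "config_dist xs ys"
  let ?p = "coord_pmf P c h xs" and ?q = "coord_pmf P c h ys"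
  have "\<forall>i. \<exists>K. bind_pmf (?p i) K = ?q i \<and>
    measure_pmf.expectation (?p i)
      (\<lambda>u. measure_pmf.expectation (K u) (trivial_dist u)) \<le> tv_norm (?p i) (?q i) / 2"
    using exists_maximal_kernel by blast
  from choice[OF this] obtain K where K: "\<And>i. bind_pmf (?p i) (K i) = ?q i"
    "\<And>i. measure_pmf.expectation (?p i) (\<lambda>u. measure_pmf.expectation (K i u)
      (trivial_dist u)) \<le> tv_norm (?p i) (?q i) / 2"
    by blast
  define \<pi> where "\<pi> = bind_pmf (pmf_of_set UNIV) (\<lambda>i. bind_pmf (?p i)
    (\<lambda>u. map_pmf (\<lambda>v. (xs(i := u), ys(i := v))) (K i u)))"
  have "map_pmf fst \<pi> = euler_pmf P c h xs"
    by (simp add: \<pi>_def euler_pmf_def map_bind_pmf map_pmf_comp map_pmf_def[of "\<lambda>u. xs(_ := u)"])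
  moreover have "map_pmf snd \<pi> = euler_pmf P c h ys"
    unfolding \<pi>_def euler_pmf_def K(1)[symmetric] by (simp add: map_bind_pmf map_pmf_comp)
  ultimately have "is_coupling \<pi> (euler_pmf P c h xs) (euler_pmf P c h ys)"
    by (simp add: is_coupling_def)
  moreover have "cost config_dist \<pi> \<le> (1 - r * h) * ?d"
  proof -
    let ?t = "\<lambda>i. trivial_dist (xs i) (ys i)"
    let ?k = "\<lambda>i. measure_pmf.expectation (?p i) (\<lambda>u. measure_pmf.expectation (K i u)
      (trivial_dist u))"
    \<comment> \<open>One inequality for both kinds of coordinate: \<open>?t i\<close> is 0 or 1,
      and in the disagreeing case the extra nonnegative term with \<open>S * ?d\<close> only weakens
      the bound.\<close>
    have step: "?k i - ?t i \<le> ?N * h * (S * ?d - (r + S) * ?t i)" for i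
    proof (cases "xs i = ys i")
      case True
      have "tv_norm (?p i)
        (?q i) / 2 = \<bar>jump_prob c h xs i - jump_prob c h ys i\<bar> * (1 - pmf (P (xs i)) (xs i))"
        unfolding coord_pmf_def True[symmetric] using adm by (intro tv_norm_lazy_same_base)
      also have "jump_prob c h xs i - jump_prob c h ys i = ?N * h * (c (xs i) xs - c (xs i) ys)"
        by (simp add: jump_prob_def True algebra_simps)
      also have "\<bar>?N * h * (c (xs i) xs - c (xs i) ys)\<bar> * (1 - pmf (P (xs i)) (xs i)) =
          ?N * h * ((1 - pmf (P (xs i)) (xs i)) * \<bar>c (xs i) xs - c (xs i) ys\<bar>)"
        using h by (simp add: abs_mult)
      also have "\<dots> \<le> ?N * h * (S * ?d)"
        using lip[OF True] h by (intro mult_left_mono) auto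
      finally show ?thesis using K(2)[of i] True by simp
    next
      case False
      have "tv_norm (?p i) (?q i) / 2 \<le> 1 - min (jump_prob c h xs i)
        (jump_prob c h ys i) * theta P (xs i) (ys i)"
        unfolding coord_pmf_def theta_def using adm by (intro tv_norm_lazy_le)
      also have "min (jump_prob c h xs i) (jump_prob c h ys i) = ?N * h * min (c (xs i) xs)
        (c (ys i) ys)"
        unfolding jump_prob_def using h by (simp add: min_mult_distrib_left)
      finally have "?k i \<le> 1 - ?N * h * (theta P (xs i) (ys i) * min (c (xs i) xs) (c (ys i) ys))"
        using K(2)[of i] by (simp add: mult_ac)
      moreover have "?N * h * (r + S) \<le> ?N * h * (theta P (xs i) (ys i) * min (c (xs i) xs)
        (c (ys i) ys))"
        using curv[OF False] h by (intro mult_left_mono) auto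
      moreover have "0 \<le> ?N * h * (S * ?d)" using h S by simp
      ultimately show ?thesis using False
        by (simp only: trivial_dist_def right_diff_distrib if_False)
    qed
    have int: "integrable (measure_pmf s) (\<lambda>u. measure_pmf.expectation (K i u)
      (trivial_dist u))" for s i
    proof (rule integrable_pmf_bounded[of _ 1])
      fix u
      have "measure_pmf.expectation (K i u) (trivial_dist u) \<le> 1"
        by (intro measure_pmf.integral_le_const integrable_pmf_bounded[of _ 1]) auto
      then show "\<bar>measure_pmf.expectation (K i u) (trivial_dist u)\<bar> \<le> 1" by simp
    qed
    have "cost config_dist \<pi> = (\<Sum>i\<in>UNIV. measure_pmf.expectation (?p i)
      (\<lambda>u. measure_pmf.expectation (K i u)
        (\<lambda>v. config_dist (xs(i := u)) (ys(i := v))))) / ?N"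
      unfolding \<pi>_def by (simp add: expectation_bind_pmf[of _ 1] integral_pmf_of_set)
    also have "\<dots> = (\<Sum>i\<in>UNIV. ?d + (?k i - ?t i) / ?N) / ?N"
    proof -
      have "measure_pmf.expectation (K i u) (\<lambda>v. config_dist (xs(i := u)) (ys(i := v))) =
          ?d - ?t i / ?N + measure_pmf.expectation (K i u) (trivial_dist u) / ?N" for i u
        by (simp add: config_dist_upd integrable_pmf_bounded[of _ 1] measure_pmf.prob_space)
      then show ?thesis
        by (simp add: int measure_pmf.prob_space diff_divide_distrib add_diff_eq diff_add_eq)
    qed
    also have "\<dots> \<le> (\<Sum>i\<in>UNIV. ?d + (?N * h * (S * ?d - (r + S) * ?t i)) / ?N) / ?N"
      using step by (intro divide_right_mono sum_mono add_left_mono) auto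
    also have "\<dots> = (\<Sum>i\<in>UNIV. ?d + h * S * ?d - h * (r + S) * ?t i) / ?N"
      by (intro arg_cong2[where f = "(/)"] sum.cong refl) (simp add: field_simps)
    \<comment> \<open>The average of \<open>?t i\<close> over the coordinates is \<open>?d\<close>
      itself.\<close>
    also have "\<dots> = ?d + h * S * ?d - h * (r + S) * ?d"
      by (simp add: sum_subtractf diff_divide_distrib config_dist_def flip: sum_distrib_left)
    finally show ?thesis by (simp add: algebra_simps)
  qed
  ultimately show ?thesis by blast
qed

section \<open>Coupling of the particle system\<close>

lemma (in countable_markov) expectation_indicator_X:
  assumes "0 \<le> t"
  shows "(\<integral>\<omega>. indicator {z} (X t \<omega>) \<partial>M x) = pmf (trans_pmf t x) z"
proof -
  interpret prob_space "M x" by simp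
  have "(\<integral>\<omega>. indicator {z} (X t \<omega>) \<partial>M x) = (\<integral>\<omega>. indicator {\<omega> \<in> space (M x). X t \<omega> = z} \<omega> \<partial>M x)"
    by (intro Bochner_Integration.integral_cong) (auto simp: indicator_def)
  also have "\<dots> = pmf (trans_pmf t x) z"
    using sets_X[OF assms, of x "{z}"] by (simp add: pmf_trans_pmf[OF assms])
  finally show ?thesis .
qed

text \<open>Pointwise convergence of the difference quotients upgrades to total variation because the Euler
  laws are tight at first order: outside a finite set containing \<open>xs\<close> their mass is linear in \<open>h\<close>.\<close>
lemma eventually_tv_norm_euler_le:
  fixes c :: "'e::countable \<Rightarrow> ('n::finite \<Rightarrow> 'e) \<Rightarrow> real" and \<epsilon> :: real
  assumes "countable_markov M X" and gen: "has_generator M X (particle_generator P c)"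
    and c: "\<And>x xs. 0 \<le> c x xs" and \<epsilon>: "0 < \<epsilon>"
  shows "\<forall>\<^sub>F h in at_right 0. tv_norm (countable_markov.trans_pmf M X h xs)
    (euler_pmf P c h xs) \<le> \<epsilon> * h"
proof -
  interpret countable_markov M X by fact
  let ?L = "particle_generator P c"
  have ev_adm: "\<forall>\<^sub>F h in at_right 0. \<forall>i. 0 \<le> jump_prob c h xs i \<and> jump_prob c h xs i \<le> 1"
    by (rule eventually_jump_prob_le_1) fact
  \<comment> \<open>A single admissible step size \<open>h1\<close> suffices to choose the finite
    set: since \<open>xs\<close> lies in it, the outside mass is \<open>h\<close> times a generator
    value independent of \<open>h\<close>, which is bounded through \<open>h1\<close>.\<close>
  from eventually_happens'[OF _ eventually_conj[OF this eventually_at_right_less[of 0]]]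
  obtain h1 :: real where h1: "0 < h1" "\<And>i. 0 \<le> jump_prob c h1 xs i" "\<And>i. jump_prob c h1 xs i \<le> 1"
    by auto
  obtain F0 where F0: "finite F0" "measure_pmf.prob (euler_pmf P c h1 xs) (- F0) < \<epsilon> * h1 / 4"
    using exists_finite_prob_Compl_less[of "\<epsilon> * h1 / 4" "euler_pmf P c h1 xs"] h1 \<epsilon> by auto
  define F where "F = insert xs F0"
  have F: "finite F" "xs \<in> F" using F0 by (auto simp: F_def)
  have "measure_pmf.prob (euler_pmf P c h1 xs) (- F) \<le> measure_pmf.prob (euler_pmf P c h1 xs)
    (- F0)"
    by (intro measure_pmf.finite_measure_mono) (auto simp: F_def)
  with F0 have tail1: "measure_pmf.prob (euler_pmf P c h1 xs) (- F) < \<epsilon> * h1 / 4" by simp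
  have prob_euler: "measure_pmf.prob (euler_pmf P c h xs) A = indicator A xs +
    h * ?L (indicator A) xs"
    if "\<forall>i. 0 \<le> jump_prob c h xs i \<and> jump_prob c h xs i \<le> 1" for h and A :: "('n \<Rightarrow> 'e) set"
    using expectation_euler_pmf[of c h xs "indicator A" P] that by simp
  have L_tail: "?L (indicator (- F)) xs \<le> \<epsilon> / 4"
    using tail1 prob_euler[of h1 "- F"] h1 F by (simp add: field_simps)
  \<comment> \<open>The tolerance is divided by \<open>card F\<close>, so that the errors on
    \<open>F\<close> add up to \<open>h * \<epsilon> / 4\<close>.\<close>
  have "\<forall>\<^sub>F h in at_right 0. \<forall>z\<in>F.
      \<bar>(pmf (trans_pmf h xs) z - indicator {z} xs) / h - ?L (indicator {z}) xs\<bar> < \<epsilon> / (4 * card F)"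
  proof (intro eventually_ball_finite ballI)
    fix z assume "z \<in> F"
    then have "0 < card F" using F card_gt_0_iff by blast
    then have pos: "0 < \<epsilon> / (4 * card F)" using \<epsilon> by simp
    have "bounded (range (indicator {z} :: _ \<Rightarrow> real))"
      by (auto simp: bounded_iff indicator_def intro!: exI[of _ 1])
    with gen have "((\<lambda>t. ((\<integral>\<omega>. indicator {z} (X t \<omega>) \<partial>M xs) - indicator {z} xs) / t) \<longlongrightarrow>
        ?L (indicator {z}) xs) (at_right 0)"
      unfolding has_generator_def by blast
    from tendstoD[OF this pos] eventually_at_right_less[of 0]
    show "\<forall>\<^sub>F h in at_right 0.
        \<bar>(pmf (trans_pmf h xs) z - indicator {z} xs) / h - ?L (indicator {z}) xs\<bar> < \<epsilon> / (4 * card F)"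
      by eventually_elim (simp add: dist_real_def expectation_indicator_X)
  qed fact
  then show ?thesis
    using ev_adm eventually_at_right_less[of 0]
  proof eventually_elim
    case (elim h)
    have "\<bar>pmf (trans_pmf h xs) z - pmf (euler_pmf P c h xs) z\<bar> \<le> h * (\<epsilon> / (4 * card F))"
      if "z \<in> F" for z
    proof -
      have "pmf (trans_pmf h xs) z - pmf (euler_pmf P c h xs) z =
        h * ((pmf (trans_pmf h xs) z - indicator {z} xs) / h - ?L (indicator {z}) xs)"
        using prob_euler[OF elim(2), of "{z}"] elim(3) by (simp add: measure_pmf_single field_simps)
      then show ?thesis
        using mult_left_mono[OF less_imp_le[OF bspec[OF elim(1) that]], of h] elim(3)
          by (simp add: abs_mult)
    qed
    then have "(\<Sum>z\<in>F. \<bar>pmf (trans_pmf h xs) z - pmf (euler_pmf P c h xs) z\<bar>) \<le>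
      (\<Sum>z\<in>F. h * (\<epsilon> / (4 * card F)))"
      by (rule sum_mono)
    also have "\<dots> = h * \<epsilon> / 4" using F by (auto simp: card_gt_0_iff)
    finally have "(\<Sum>z\<in>F. \<bar>pmf (trans_pmf h xs) z - pmf (euler_pmf P c h xs) z\<bar>) \<le> h * \<epsilon> / 4" .
    moreover have "measure_pmf.prob (euler_pmf P c h xs) (- F) \<le> h * (\<epsilon> / 4)"
      using prob_euler[OF elim(2), of "- F"] F L_tail elim(3) by (simp add: mult_left_mono)
    \<comment> \<open>The factor 2 in \<open>tv_norm_le\<close> turns the two quarters into
      \<open>\<epsilon> * h\<close>.\<close>
    ultimately show ?case
      using tv_norm_le[OF F(1), of "trans_pmf h xs" "euler_pmf P c h xs"]
        by (simp add: algebra_simps)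
  qed
qed

text \<open>Glue the Euler coupling to the true laws at time \<open>h\<close>. The two total
  variation errors, each halved, add up to \<open>\<epsilon> * h\<close>, and 1 - r h is at most exp
  (- r h).\<close>

lemma local_coupling:
  fixes c :: "'e::countable \<Rightarrow> ('n::finite \<Rightarrow> 'e) \<Rightarrow> real" and \<epsilon> :: real
  assumes mk: "countable_markov M X" and gen: "has_generator M X (particle_generator P c)"
    and c: "\<And>x xs. 0 \<le> c x xs" and \<epsilon>: "0 < \<epsilon>" and S: "0 \<le> S"
    and lip: "\<And>i. xs i = ys i \<Longrightarrow>
      (1 - pmf (P (xs i)) (xs i)) * \<bar>c (xs i) xs - c (xs i) ys\<bar> \<le> S * config_dist xs ys"
    and curv: "\<And>i. xs i \<noteq> ys i \<Longrightarrow> r + S \<le> theta P (xs i) (ys i) * min (c (xs i) xs) (c (ys i) ys)"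
  shows "\<forall>\<^sub>F h in at_right 0. \<exists>\<pi>.
    is_coupling \<pi> (countable_markov.trans_pmf M X h xs) (countable_markov.trans_pmf M X h ys) \<and>
    cost config_dist \<pi> \<le> exp (- r * h) * config_dist xs ys + \<epsilon> * h"
  using eventually_tv_norm_euler_le[OF mk gen c \<epsilon>, of xs] eventually_tv_norm_euler_le[OF mk gen c \<epsilon>, of ys]
    eventually_jump_prob_le_1[of c xs, OF c] eventually_jump_prob_le_1[of c ys, OF c]
    eventually_at_right_less[of 0]
proof eventually_elim
  case (elim h)
  let ?p = "countable_markov.trans_pmf M X h"
  obtain \<pi> where \<pi>: "is_coupling \<pi> (euler_pmf P c h xs) (euler_pmf P c h ys)"
    "cost config_dist \<pi> \<le> (1 - r * h) * config_dist xs ys"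
    using euler_coupling[of c h xs ys S P r] elim S lip curv by auto
  obtain \<pi>' where \<pi>': "is_coupling \<pi>' (?p xs) (?p ys)"
    "cost config_dist \<pi>' \<le> cost config_dist \<pi> +
      tv_norm (euler_pmf P c h xs) (?p xs) / 2 + tv_norm (euler_pmf P c h ys) (?p ys) / 2"
    using glue_coupling[where d = config_dist, OF _ _ config_dist_perturb \<pi>(1)] by auto
  have "(1 - r * h) * config_dist xs ys \<le> exp (- r * h) * config_dist xs ys"
    using exp_ge_add_one_self[of "- r * h"] by (intro mult_right_mono) auto
  with \<pi>(2) \<pi>'(2) elim(1,2) have "cost config_dist \<pi>' \<le> exp (- r * h) * config_dist xs ys + \<epsilon> * h"
    by (simp add: tv_norm_commute)
  with \<pi>'(1) show ?case by blast
qed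

lemma config_dist_pos: "xs \<noteq> ys \<Longrightarrow> 0 < config_dist xs ys"
proof -
  assume "xs \<noteq> ys"
  then obtain i where "xs i \<noteq> ys i" by auto
  then have "0 < (\<Sum>i\<in>UNIV. trivial_dist (xs i) (ys i))"
    by (intro sum_pos2[of _ i]) (auto simp: trivial_dist_def)
  then show ?thesis by (simp add: config_dist_def)
qed

text \<open>Every real \<open>r\<close> strictly below the bound is shown to be admissible. Taking
  \<open>r\<close> strictly below avoids arithmetic with infinite values and yields a finite
  \<open>S\<close> with the two pointwise hypotheses of \<open>local_coupling\<close>.\<close>

theorem corollary4p1:
  fixes P :: "'e::countable \<Rightarrow> 'e pmf"
    and c :: "'e \<Rightarrow> ('n::finite \<Rightarrow> 'e) \<Rightarrow> real"
    and M :: "('n \<Rightarrow> 'e) \<Rightarrow> 'w measure"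
    and X :: "real \<Rightarrow> 'w \<Rightarrow> 'n \<Rightarrow> 'e"
  assumes "\<And>x xs. 0 \<le> c x xs"
    and "markov_process M X"
    and "nonexplosive M X"
    and "has_generator M X (particle_generator P c)"
  shows "coarse_ricci config_dist (transition_law M X) \<ge>
    (INF (xs, ys, x, y) \<in>
        {(xs :: 'n \<Rightarrow> 'e, ys :: 'n \<Rightarrow> 'e, x, y). xs \<noteq> ys \<and> x \<in> range xs \<and> y \<in> range ys}.
      ereal (theta P x y * min (c x xs) (c y ys)))
    - enn2ereal (SUP x. ennreal (1 - pmf (P x) x) * lip_norm x (c x))"
    (is "_ \<ge> ?I - enn2ereal ?S")
proof (rule dense_le)
  interpret countable_markov M X by unfold_locales fact
  fix w :: ereal assume w: "w < ?I - enn2ereal ?S"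
  show "w \<le> coarse_ricci config_dist (transition_law M X)"
  proof (cases w)
    case (real r)
    have "\<exists>S\<ge>0. (\<forall>xs ys i. xs i = ys i \<longrightarrow>
         (1 - pmf (P (xs i)) (xs i)) * \<bar>c (xs i) xs - c (xs i) ys\<bar> \<le> S * config_dist xs ys) \<and>
       (\<forall>xs ys i. xs i \<noteq> ys i \<longrightarrow> r + S \<le> theta P (xs i) (ys i) * min (c (xs i) xs) (c (ys i) ys))"
    proof (cases "\<exists>xs ys :: 'n \<Rightarrow> 'e. xs \<noteq> ys")
      case True
      then obtain xs0 ys0 :: "'n \<Rightarrow> 'e" where "xs0 \<noteq> ys0" by blast
      have I_le: "?I \<le> ereal (theta P (xs i) (ys j) * min (c (xs i) xs) (c (ys j) ys))"
        if "xs \<noteq> ys" for xs ys i j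
        using that by (intro INF_lower2[of "(xs, ys, xs i, ys j)"]) auto
      have "?I \<noteq> \<infinity>" using I_le[OF \<open>xs0 \<noteq> ys0\<close>] by auto
      \<comment> \<open>With \<open>?I\<close> below infinity, an infinite \<open>?S\<close> would
        make the bound minus infinity, and no \<open>w\<close> lies strictly below that.\<close>
      moreover have "s \<noteq> \<top>" if "w < a - enn2ereal s" "a \<noteq> \<infinity>" for a s
        using that by (cases a) (auto simp: top_ennreal.rep_eq)
      ultimately have "?S \<noteq> \<top>" using w by blast
      then obtain S where S: "0 \<le> S" "?S = ennreal S" by (cases ?S) auto
      have "(1 - pmf (P (xs i)) (xs i)) * \<bar>c (xs i) xs - c (xs i) ys\<bar> \<le> S * config_dist xs ys"
        if i: "xs i = ys i" for xs ys i
      proof (cases "xs = ys")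
        case False
        let ?q = "\<bar>c (xs i) xs - c (xs i) ys\<bar> / config_dist xs ys"
        have "ennreal ?q \<le> lip_norm (xs i) (c (xs i))"
          unfolding lip_norm_def using False rangeI[of xs i] rangeI[of ys i] i
          by (intro SUP_upper2[of "(xs, ys)"]) auto
        then have "ennreal (1 - pmf (P (xs i)) (xs i)) * ennreal ?q \<le> ?S"
          by (intro SUP_upper2[of "xs i"] mult_left_mono) auto
        then have "(1 - pmf (P (xs i)) (xs i)) * ?q \<le> S"
          using S by (simp add: pmf_le_1 flip: ennreal_mult)
        then show ?thesis using config_dist_pos[OF False] by (simp add: field_simps)
      qed simp
      moreover have "r + S \<le> theta P (xs i) (ys i) * min (c (xs i) xs) (c (ys i) ys)"
        if "xs i \<noteq> ys i" for xs ys i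
      proof -
        have "xs \<noteq> ys" using that by auto
        from I_le[OF this, of i i] w S show ?thesis
          unfolding real by (cases ?I) (auto simp: enn2ereal_ennreal)
      qed
      ultimately show ?thesis using S(1) by blast
    next
      \<comment> \<open>There is only one configuration: the infimum is over an empty set and equals
        infinity, and \<open>S = 0\<close> works for every \<open>r\<close>.\<close>
      case False
      then have eq: "xs = ys" for xs ys :: "'n \<Rightarrow> 'e" by blast
      have "(1 - pmf (P (xs i)) (xs i)) * \<bar>c (xs i) xs - c (xs i) ys\<bar> \<le> 0 * config_dist xs ys"
        for xs ys i
        using eq[of xs ys] by simp
      moreover have "xs i = ys i" for xs ys :: "'n \<Rightarrow> 'e" and i
        using eq[of xs ys] by simp
      ultimately show ?thesis by blast
    qed
    then obtain S where S: "0 \<le> S"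
      "\<And>xs ys i. xs i = ys i \<Longrightarrow>
         (1 - pmf (P (xs i)) (xs i)) * \<bar>c (xs i) xs - c (xs i) ys\<bar> \<le> S * config_dist xs ys"
      "\<And>xs ys i. xs i \<noteq> ys i \<Longrightarrow> r + S \<le> theta P (xs i) (ys i) * min (c (xs i) xs) (c (ys i) ys)"
      by blast
    show ?thesis
      unfolding real
    proof (rule coarse_ricci_ge_of_local_coupling)
      fix xs ys :: "'n \<Rightarrow> 'e" and \<epsilon> :: real assume "0 < \<epsilon>"
      then show "\<forall>\<^sub>F h in at_right 0. \<exists>\<pi>. is_coupling \<pi> (trans_pmf h xs) (trans_pmf h ys) \<and>
          cost config_dist \<pi> \<le> exp (- r * h) * config_dist xs ys + \<epsilon> * h"
        by (rule local_coupling[OF countable_markov_axioms assms(4,1) _ S])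
    qed (use assms in auto)
  qed (use w in auto)
qed

end
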